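(* Let $f:\mathcal{R}\to\Omega$ be a social choice rule with range $\Omega$. The following statements are equivalent: (i) $f$ is strategy-proof (SP). (ii) $f$ is group strategy-proof (GSP). (iii) There are a generalized median voter function $\omega$ with range $r_\omega$, where $r_\omega$ satisfies the range conditions, and a family $\{g_\alpha:\mathcal{R}\to\{\underline{\alpha},\overline{\alpha}\}\}_{\alpha\in r_\omega\cap\Omega^2_C}$ such that each $g_\alpha$ is a voting by collections of left-decisive sets, and such that for each $R\in\mathcal{R}$ with $p(R)=\mathbf{p}$, $$f(R)=\begin{cases}\omega(\mathbf{p}) & \text{if } \omega(\mathbf{p})\in\Omega,\\ g_{\omega(\mathbf{p})}(R) & \text{if } \omega(\mathbf{p})\in\Omega^2_C.\end{cases}$$
   Context: Model. $X\subseteq\mathbb{R}$ is a set of alternatives; $N=\{1,\dots,n\}$ is a finite set of agents partitioned into $A$ (with $|A|=a$, possibly $0$) and $D=N\setminus A$ (possibly empty). A preference $R_i$ is a complete, transitive, antisymmetric binary relation on $X$ with strict part $P_i$. For $i\in A$, $\mathcal{R}_i$ is the set of all single-peaked preferences: those for which there is $\rho(R_i)\in X$ such that for all $x,y\in X$, [$\rho(R_i)\ge x>y$ or $\rho(R_i)\le x<y$] implies $x\,P_i\,y$. For $i\in D$, $\mathcal{R}_i$ is the set of all single-dipped preferences: those for which there is $\delta(R_i)\in X$ such that for all $x,y\in X$, [$\delta(R_i)\ge x>y$ or $\delta(R_i)\le x<y$] implies $y\,P_i\,x$. $\mathcal{R}=\times_{i\in N}\mathcal{R}_i$; for $S\subseteq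 N$, $R_S$ and $R_{-S}$ are the restrictions of $R$ to $S$ and $N\setminus S$. A social choice rule is a function $f:\mathcal{R}\to X$; $\Omega$ denotes its range, and writing $f:\mathcal{R}\to\Omega$ means that the range of $f$ is $\Omega$. Standing assumptions: $\mathbb{R}\setminus\Omega$ is either empty or a union of open sets, and $|\Omega|\ge2$. $f$ is manipulable by a nonempty group $S\subseteq N$ if there are $R\in\mathcal{R}$ and $R'_S\in\times_{i\in S}\mathcal{R}_i$ with $f(R'_S,R_{-S})\,P_i\,f(R)$ for each $i\in S$. $f$ is GSP if it is not manipulable by any nonempty group, and SP if it is not manipulable by any group of size $1$. For $i\in A$, $p(R_i)$ is the best element of $\Omega$ under $R_i$; $p(R)=(p(R_i))_{i\in A}\in\Omega^a$ (for $a=0$, $\Omega^a$ contains only the empty vector). $\Omega^2_C=\{(x,y)\in\Omega\times\Omega: x<y,\ (x,y)\cap\Omega=\emptyset\}$ (in the last condition $(x,y)$ is the open interval). For $\alpha=(x,y)\in\Omega^2_C$ put $\underline{\alpha}=x$, $\overline{\alpha}=y$. The order $\leq^*$ on $\Omega\cup\Omega^2_C$ (strict part $<^*$) is the complete transitive relation that agrees with $\le$ on $\Omega$ and satisfies $x<^*(x,y)<^*y$ for each $(x,y)\in\Omega^2_C$. Range conditions on a set $r_\omega$: (1) $\Omega\setminus\{\min\Omega,\max\Omega\}\subseteq r_\omega\subseteq\Omega\cup\Omega^2_C$ (removing $\min\Omega,\max\Omega$ when they exist); (2) if $\min\Omega$ exists and there is no $x\in\Omega$ with $(\min\Omega,x)\in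 r_\omega$, then $\min\Omega\in r_\omega$; (3) if $\max\Omega$ exists and there is no $x\in\Omega$ with $(x,\max\Omega)\in r_\omega$, then $\max\Omega\in r_\omega$. A left coalition system on $r_\omega$ is a map $\mathcal{L}$ assigning to each $\alpha\in r_\omega$ a collection $\mathcal{L}(\alpha)\subseteq2^A$ such that: (i) if $C\in\mathcal{L}(\alpha)$ and $C\subset C'\subseteq A$, then $C'\in\mathcal{L}(\alpha)$; (ii) if $\alpha<^*\beta$ and $C\in\mathcal{L}(\alpha)$, then $C\in\mathcal{L}(\beta)$; (iii) if $\max\Omega$ exists and $\max\Omega\notin r_\omega$, then $\emptyset\in\mathcal{L}(\max r_\omega)\setminus\mathcal{L}(\alpha)$ for each $\alpha\in r_\omega\setminus\{\max r_\omega\}$ (max with respect to $\leq^*$); (iv) if $\max\Omega$ does not exist, then $\emptyset\notin\mathcal{L}(\alpha)$ for each $\alpha\in r_\omega$. A function $\omega$ on $\Omega^a$ with range $r_\omega$ (satisfying the range conditions) is a generalized median voter function if there is a left coalition system $\mathcal{L}$ on $r_\omega$ (the associated one) such that for each $\mathbf{p}\in\Omega^a$ and $\alpha\in r_\omega$: $\omega(\mathbf{p})=\alpha$ if and only if $\{i\in A:\mathbf{p}_i\leq^*\alpha\}\in\mathcal{L}(\alpha)$ and $\{i\in A:\mathbf{p}_i\leq^*\beta\}\notin\mathcal{L}(\beta)$ for each $\beta\in r_\omega$ with $\beta<^*\alpha$. A coalition $B$ is minimal in a collection $V$ if $B\in V$ and no proper subset of $B$ is in $V$; $V$ is minimal if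 all its members are minimal in $V$. Given $\omega$ with associated $\mathcal{L}$ and $\alpha\in r_\omega\cap\Omega^2_C$, let $L_\alpha(R)=\{i\in N:\underline{\alpha}\,P_i\,\overline{\alpha}\}$. The function $g_\alpha$ is a voting by collections of left-decisive sets if there is a minimal collection $W(g_\alpha)\subseteq2^N$ such that for each $R\in\mathcal{R}$ with $\omega(p(R))=\alpha$, $g_\alpha(R)=\underline{\alpha}$ if $C\subseteq L_\alpha(R)$ for some $C\in W(g_\alpha)$ and $g_\alpha(R)=\overline{\alpha}$ otherwise, and moreover: (i) $C\cap D\ne\emptyset$ for each $C\in W(g_\alpha)$; (ii) for each minimal coalition $B$ of $\mathcal{L}(\alpha)\setminus\mathcal{L}(\underline{\alpha})$ there is $C\in W(g_\alpha)$ with $C\cap A=B$ (with the convention $\mathcal{L}(\underline{\alpha})=\emptyset$ if $\underline{\alpha}\notin r_\omega$). *)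

theory Defs
  imports "HOL-Analysis.Analysis" "HOL-Library.FuncSet"
begin

text \<open>
  A preference on \<open>X\<close> is a linear order in the sense of \<^const>\<open>linear_order_on\<close>, where
  \<open>(x, y) \<in> R\<close> reads ``\<open>x\<close> is at least as good as \<open>y\<close>''. So the best alternative is the
  \<open>R\<close>-first one, not the \<open>R\<close>-last one.
\<close>

definition strictly_prefers :: "real rel \<Rightarrow> real \<Rightarrow> real \<Rightarrow> bool" where
  "strictly_prefers R x y \<longleftrightarrow> (x, y) \<in> R \<and> (y, x) \<notin> R"

definition single_peaked :: "real set \<Rightarrow> real rel \<Rightarrow> bool" where
  "single_peaked X R \<longleftrightarrow> linear_order_on X R \<and>
     (\<exists>\<rho>\<in>X. \<forall>x\<in>X. \<forall>y\<in>X. (\<rho> \<ge> x \<and> x > y) \<or> (\<rho> \<le> x \<and> x < y) \<longrightarrow> strictly_prefers R x y)"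

definition single_dipped :: "real set \<Rightarrow> real rel \<Rightarrow> bool" where
  "single_dipped X R \<longleftrightarrow> linear_order_on X R \<and>
     (\<exists>\<delta>\<in>X. \<forall>x\<in>X. \<forall>y\<in>X. (\<delta> \<ge> x \<and> x > y) \<or> (\<delta> \<le> x \<and> x < y) \<longrightarrow> strictly_prefers R y x)"

definition prefs :: "real set \<Rightarrow> nat set \<Rightarrow> nat \<Rightarrow> real rel set" where
  "prefs X A i = (if i \<in> A then {R. single_peaked X R} else {R. single_dipped X R})"

text \<open>
  Throughout, \<open>A\<close> and \<open>D\<close> are the disjoint sets of agents with single-peaked and with single-dipped
  preferences, and \<open>A \<union> D\<close> is the set \<open>N\<close> of all agents.
\<close>

definition profiles :: "real set \<Rightarrow> nat set \<Rightarrow> nat set \<Rightarrow> (nat \<Rightarrow> real rel) set" where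
  "profiles X A D = (\<Pi>\<^sub>E i\<in>A \<union> D. prefs X A i)"

definition manipulable_by ::
  "real set \<Rightarrow> nat set \<Rightarrow> nat set \<Rightarrow> ((nat \<Rightarrow> real rel) \<Rightarrow> real) \<Rightarrow> nat set \<Rightarrow> bool" where
  "manipulable_by X A D f S \<longleftrightarrow>
     (\<exists>R\<in>profiles X A D. \<exists>R'\<in>(\<Pi>\<^sub>E i\<in>S. prefs X A i).
        \<forall>i\<in>S. strictly_prefers (R i) (f (override_on R R' S)) (f R))"

definition group_strategy_proof ::
  "real set \<Rightarrow> nat set \<Rightarrow> nat set \<Rightarrow> ((nat \<Rightarrow> real rel) \<Rightarrow> real) \<Rightarrow> bool" where
  "group_strategy_proof X A D f \<longleftrightarrow>
     (\<forall>S. S \<subseteq> A \<union> D \<and> S \<noteq> {} \<longrightarrow> \<not> manipulable_by X A D f S)"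

definition strategy_proof ::
  "real set \<Rightarrow> nat set \<Rightarrow> nat set \<Rightarrow> ((nat \<Rightarrow> real rel) \<Rightarrow> real) \<Rightarrow> bool" where
  "strategy_proof X A D f \<longleftrightarrow>
     (\<forall>S. S \<subseteq> A \<union> D \<and> card S = 1 \<longrightarrow> \<not> manipulable_by X A D f S)"

definition best :: "real set \<Rightarrow> real rel \<Rightarrow> real" where
  "best \<Omega> R = (THE x. x \<in> \<Omega> \<and> (\<forall>y\<in>\<Omega>. (x, y) \<in> R))"

definition peaks :: "nat set \<Rightarrow> real set \<Rightarrow> (nat \<Rightarrow> real rel) \<Rightarrow> nat \<Rightarrow> real" where
  "peaks A \<Omega> R = (\<lambda>i\<in>A. best \<Omega> (R i))"

definition is_min :: "real set \<Rightarrow> real \<Rightarrow> bool" where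
  "is_min S m \<longleftrightarrow> m \<in> S \<and> (\<forall>x\<in>S. m \<le> x)"

definition is_max :: "real set \<Rightarrow> real \<Rightarrow> bool" where
  "is_max S m \<longleftrightarrow> m \<in> S \<and> (\<forall>x\<in>S. x \<le> m)"

definition gap_pairs :: "real set \<Rightarrow> (real \<times> real) set" where
  "gap_pairs \<Omega> = {(x, y) \<in> \<Omega> \<times> \<Omega>. x < y \<and> {x<..<y} \<inter> \<Omega> = {}}"

text \<open>
  The union of \<open>\<Omega>\<close> and \<open>gap_pairs \<Omega>\<close> is represented by the disjoint sum \<open>\<Omega> <+> gap_pairs \<Omega>\<close>.
  The order below is given by explicit clauses; \<open>le_star_total\<close>, \<open>le_star_trans\<close>,
  \<open>le_star_gap\<close> and \<open>le_star_unique\<close> show that on this set it is the only complete transitive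
  relation that extends \<open>\<le>\<close> on \<open>\<Omega>\<close> and places each pair strictly between its components.
\<close>

fun le_star :: "real + real \<times> real \<Rightarrow> real + real \<times> real \<Rightarrow> bool"  (infix "\<le>\<^sup>*" 50) where
  "Inl x \<le>\<^sup>* Inl y \<longleftrightarrow> x \<le> y"
| "Inl z \<le>\<^sup>* Inr (x, y) \<longleftrightarrow> z \<le> x"
| "Inr (x, y) \<le>\<^sup>* Inl z \<longleftrightarrow> y \<le> z"
| "Inr (x, y) \<le>\<^sup>* Inr (x', y') \<longleftrightarrow> x \<le> x'"

definition less_star :: "real + real \<times> real \<Rightarrow> real + real \<times> real \<Rightarrow> bool"  (infix "<\<^sup>*" 50) where
  "\<alpha> <\<^sup>* \<beta> \<longleftrightarrow> \<alpha> \<le>\<^sup>* \<beta> \<and> \<not> \<beta> \<le>\<^sup>* \<alpha>"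

lemma gap_pairs_cases:
  assumes "(x, y) \<in> gap_pairs \<Omega>" "z \<in> \<Omega>"
  shows "z \<le> x \<or> y \<le> z"
  using assms by (force simp: gap_pairs_def)

lemma gap_pairs_eq_or_apart:
  assumes "(x, y) \<in> gap_pairs \<Omega>" "(x', y') \<in> gap_pairs \<Omega>"
  shows "(x = x' \<and> y = y') \<or> y \<le> x' \<or> y' \<le> x"
proof -
  have "x \<in> \<Omega>" "y \<in> \<Omega>" "x < y" "x' \<in> \<Omega>" "y' \<in> \<Omega>" "x' < y'"
    using assms by (auto simp: gap_pairs_def)
  then show ?thesis
    using gap_pairs_cases[OF assms(1), of x'] gap_pairs_cases[OF assms(1), of y']
      gap_pairs_cases[OF assms(2), of x] gap_pairs_cases[OF assms(2), of y]
    by linarith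
qed

lemma le_star_total:
  assumes "\<alpha> \<in> \<Omega> <+> gap_pairs \<Omega>" "\<beta> \<in> \<Omega> <+> gap_pairs \<Omega>"
  shows "\<alpha> \<le>\<^sup>* \<beta> \<or> \<beta> \<le>\<^sup>* \<alpha>"
  using assms by (auto dest: gap_pairs_cases)

lemma le_star_trans:
  assumes "\<alpha> \<in> \<Omega> <+> gap_pairs \<Omega>" "\<beta> \<in> \<Omega> <+> gap_pairs \<Omega>" "\<gamma> \<in> \<Omega> <+> gap_pairs \<Omega>"
    and "\<alpha> \<le>\<^sup>* \<beta>" "\<beta> \<le>\<^sup>* \<gamma>"
  shows "\<alpha> \<le>\<^sup>* \<gamma>"
proof -
  have lt: "x < y" if "(x, y) \<in> gap_pairs \<Omega>" for x y
    using that by (auto simp: gap_pairs_def)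
  from assms show ?thesis
    by (elim PlusE; clarsimp)
      (smt (verit) lt gap_pairs_eq_or_apart)+
qed

lemma le_star_gap:
  assumes "(x, y) \<in> gap_pairs \<Omega>"
  shows "Inl x <\<^sup>* Inr (x, y)" "Inr (x, y) <\<^sup>* Inl y"
  using assms by (auto simp: less_star_def gap_pairs_def)

lemma le_star_unique:
  fixes Q :: "real + real \<times> real \<Rightarrow> real + real \<times> real \<Rightarrow> bool"
  assumes tot: "\<And>\<alpha> \<beta>. \<alpha> \<in> \<Omega> <+> gap_pairs \<Omega> \<Longrightarrow> \<beta> \<in> \<Omega> <+> gap_pairs \<Omega> \<Longrightarrow> Q \<alpha> \<beta> \<or> Q \<beta> \<alpha>"
    and trans: "\<And>\<alpha> \<beta> \<gamma>. \<alpha> \<in> \<Omega> <+> gap_pairs \<Omega> \<Longrightarrow> \<beta> \<in> \<Omega> <+> gap_pairs \<Omega> \<Longrightarrow>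
       \<gamma> \<in> \<Omega> <+> gap_pairs \<Omega> \<Longrightarrow> Q \<alpha> \<beta> \<Longrightarrow> Q \<beta> \<gamma> \<Longrightarrow> Q \<alpha> \<gamma>"
    and agree: "\<And>x y. x \<in> \<Omega> \<Longrightarrow> y \<in> \<Omega> \<Longrightarrow> Q (Inl x) (Inl y) \<longleftrightarrow> x \<le> y"
    and gap: "\<And>x y. (x, y) \<in> gap_pairs \<Omega> \<Longrightarrow>
       Q (Inl x) (Inr (x, y)) \<and> \<not> Q (Inr (x, y)) (Inl x) \<and>
       Q (Inr (x, y)) (Inl y) \<and> \<not> Q (Inl y) (Inr (x, y))"
    and "\<alpha> \<in> \<Omega> <+> gap_pairs \<Omega>" "\<beta> \<in> \<Omega> <+> gap_pairs \<Omega>"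
  shows "Q \<alpha> \<beta> \<longleftrightarrow> \<alpha> \<le>\<^sup>* \<beta>"
proof -
  have mem: "x \<in> \<Omega> \<and> y \<in> \<Omega> \<and> x < y" if "(x, y) \<in> gap_pairs \<Omega>" for x y
    using that by (auto simp: gap_pairs_def)
  have LR: "Q (Inl z) (Inr (x, y)) \<longleftrightarrow> z \<le> x" if "z \<in> \<Omega>" "(x, y) \<in> gap_pairs \<Omega>" for x y z
    using that mem[OF that(2)] gap[OF that(2)] agree gap_pairs_cases[OF that(2,1)]
      trans[of "Inl z" "Inl x" "Inr (x, y)"] trans[of "Inl y" "Inl z" "Inr (x, y)"]
    by (smt (verit) InlI InrI)
  have RL: "Q (Inr (x, y)) (Inl z) \<longleftrightarrow> y \<le> z" if "z \<in> \<Omega>" "(x, y) \<in> gap_pairs \<Omega>" for x y z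
    using that mem[OF that(2)] gap[OF that(2)] agree gap_pairs_cases[OF that(2,1)]
      trans[of "Inr (x, y)" "Inl y" "Inl z"] trans[of "Inr (x, y)" "Inl z" "Inl x"]
    by (smt (verit) InlI InrI)
  have RR: "Q (Inr (x, y)) (Inr (x', y')) \<longleftrightarrow> x \<le> x'"
    if g: "(x, y) \<in> gap_pairs \<Omega>" "(x', y') \<in> gap_pairs \<Omega>" for x y x' y'
  proof -
    consider "x = x' \<and> y = y'" | "y \<le> x'" | "y' \<le> x"
      using gap_pairs_eq_or_apart[OF g] by blast
    then show ?thesis
    proof cases
      case 1
      then show ?thesis using tot[of "Inr (x, y)" "Inr (x, y)"] g by auto
    next
      case 2
      have "Q (Inr (x, y)) (Inl x')" using RL[of x' x y] g 2 mem by blast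
      then have "Q (Inr (x, y)) (Inr (x', y'))"
        using trans[of "Inr (x, y)" "Inl x'" "Inr (x', y')"] gap[OF g(2)] mem[OF g(2)] g by blast
      then show ?thesis using 2 mem[OF g(1)] by simp
    next
      case 3
      have "\<not> Q (Inr (x, y)) (Inr (x', y'))"
      proof
        assume "Q (Inr (x, y)) (Inr (x', y'))"
        then have "Q (Inr (x, y)) (Inl y')"
          using trans[of "Inr (x, y)" "Inr (x', y')" "Inl y'"] gap[OF g(2)] mem[OF g(2)] g by blast
        then show False using RL[of y' x y] g 3 mem[OF g(1)] mem[OF g(2)] by auto
      qed
      then show ?thesis using 3 mem[OF g(1)] mem[OF g(2)] by auto
    qed
  qed
  show ?thesis
    using assms(5,6) by (elim PlusE) (auto simp: agree LR RL RR)
qed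

definition range_conditions :: "real set \<Rightarrow> (real + real \<times> real) set \<Rightarrow> bool" where
  "range_conditions \<Omega> r \<longleftrightarrow>
     Inl ` {x \<in> \<Omega>. \<not> is_min \<Omega> x \<and> \<not> is_max \<Omega> x} \<subseteq> r \<and> r \<subseteq> \<Omega> <+> gap_pairs \<Omega> \<and>
     (\<forall>m. is_min \<Omega> m \<and> \<not> (\<exists>x\<in>\<Omega>. Inr (m, x) \<in> r) \<longrightarrow> Inl m \<in> r) \<and>
     (\<forall>m. is_max \<Omega> m \<and> \<not> (\<exists>x\<in>\<Omega>. Inr (x, m) \<in> r) \<longrightarrow> Inl m \<in> r)"

definition left_coalition_system ::
  "nat set \<Rightarrow> real set \<Rightarrow> (real + real \<times> real) set \<Rightarrow> (real + real \<times> real \<Rightarrow> nat set set) \<Rightarrow> bool"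
where
  "left_coalition_system A \<Omega> r \<L> \<longleftrightarrow>
     (\<forall>\<alpha>\<in>r. \<L> \<alpha> \<subseteq> Pow A) \<and>
     (\<forall>\<alpha>\<in>r. \<forall>C C'. C \<in> \<L> \<alpha> \<and> C \<subset> C' \<and> C' \<subseteq> A \<longrightarrow> C' \<in> \<L> \<alpha>) \<and>
     (\<forall>\<alpha>\<in>r. \<forall>\<beta>\<in>r. \<forall>C. \<alpha> <\<^sup>* \<beta> \<and> C \<in> \<L> \<alpha> \<longrightarrow> C \<in> \<L> \<beta>) \<and>
     (\<forall>m. is_max \<Omega> m \<and> Inl m \<notin> r \<longrightarrow>
        (\<exists>\<mu>\<in>r. (\<forall>\<alpha>\<in>r. \<alpha> \<le>\<^sup>* \<mu>) \<and> (\<forall>\<alpha>\<in>r - {\<mu>}. {} \<in> \<L> \<mu> - \<L> \<alpha>))) \<and>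
     ((\<nexists>m. is_max \<Omega> m) \<longrightarrow> (\<forall>\<alpha>\<in>r. {} \<notin> \<L> \<alpha>))"

text \<open>\<open>\<omega>\<close> is a generalized median voter function with range \<open>r\<close> and associated system \<open>\<L>\<close>.\<close>

definition generalized_median_voter ::
  "nat set \<Rightarrow> real set \<Rightarrow> (real + real \<times> real) set \<Rightarrow> (real + real \<times> real \<Rightarrow> nat set set) \<Rightarrow>
    ((nat \<Rightarrow> real) \<Rightarrow> real + real \<times> real) \<Rightarrow> bool" where
  "generalized_median_voter A \<Omega> r \<L> \<omega> \<longleftrightarrow>
     \<omega> ` (A \<rightarrow>\<^sub>E \<Omega>) = r \<and> range_conditions \<Omega> r \<and> left_coalition_system A \<Omega> r \<L> \<and>
     (\<forall>p\<in>A \<rightarrow>\<^sub>E \<Omega>. \<forall>\<alpha>\<in>r.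
        \<omega> p = \<alpha> \<longleftrightarrow>
          {i \<in> A. Inl (p i) \<le>\<^sup>* \<alpha>} \<in> \<L> \<alpha> \<and>
          (\<forall>\<beta>\<in>r. \<beta> <\<^sup>* \<alpha> \<longrightarrow> {i \<in> A. Inl (p i) \<le>\<^sup>* \<beta>} \<notin> \<L> \<beta>))"

definition minimal_in :: "nat set set \<Rightarrow> nat set \<Rightarrow> bool" where
  "minimal_in V B \<longleftrightarrow> B \<in> V \<and> (\<forall>B'\<in>V. \<not> B' \<subset> B)"

definition minimal_collection :: "nat set set \<Rightarrow> bool" where
  "minimal_collection V \<longleftrightarrow> (\<forall>B\<in>V. minimal_in V B)"

definition left_supporters :: "nat set \<Rightarrow> nat set \<Rightarrow> real \<times> real \<Rightarrow> (nat \<Rightarrow> real rel) \<Rightarrow> nat set" where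
  "left_supporters A D \<alpha> R = {i \<in> A \<union> D. strictly_prefers (R i) (fst \<alpha>) (snd \<alpha>)}"

definition voting_by_left_decisive_sets ::
  "real set \<Rightarrow> nat set \<Rightarrow> nat set \<Rightarrow> real set \<Rightarrow> (real + real \<times> real) set \<Rightarrow>
    (real + real \<times> real \<Rightarrow> nat set set) \<Rightarrow> ((nat \<Rightarrow> real) \<Rightarrow> real + real \<times> real) \<Rightarrow>
    real \<times> real \<Rightarrow> ((nat \<Rightarrow> real rel) \<Rightarrow> real) \<Rightarrow> bool" where
  "voting_by_left_decisive_sets X A D \<Omega> r \<L> \<omega> \<alpha> g \<longleftrightarrow>
     (\<exists>W. W \<subseteq> Pow (A \<union> D) \<and> minimal_collection W \<and>
        (\<forall>R\<in>profiles X A D. \<omega> (peaks A \<Omega> R) = Inr \<alpha> \<longrightarrow>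
           g R = (if \<exists>C\<in>W. C \<subseteq> left_supporters A D \<alpha> R then fst \<alpha> else snd \<alpha>)) \<and>
        (\<forall>C\<in>W. C \<inter> D \<noteq> {}) \<and>
        (\<forall>B. minimal_in (\<L> (Inr \<alpha>) - (if Inl (fst \<alpha>) \<in> r then \<L> (Inl (fst \<alpha>)) else {})) B \<longrightarrow>
           (\<exists>C\<in>W. C \<inter> A = B)))"

end

theory Submission
  imports Defs
begin

text \<open>
  For the characterization, the main fact is unanimity at interior points: if all single-peaked
  agents have their best outcome at a \<open>y\<close> that is neither the minimum nor the maximum of \<open>\<Omega>\<close>,
  then \<open>y\<close> is chosen whatever the single-dipped agents report. Hence an agent with extremal point
  \<open>y\<close> can never move the outcome across \<open>y\<close>, so the option set of a single-dipped agent is a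
  singleton or a pair of adjacent outcomes, and that of a single-peaked agent is convex in \<open>\<Omega>\<close>.
  Consequently, whether \<open>f R \<le> c\<close> depends monotonically on the set of agents with peak at most
  \<open>c\<close> together with the single-dipped agents who prefer \<open>c\<close> to its successor in \<open>\<Omega>\<close>, and once
  the peaks are fixed the outcomes form a singleton or an adjacent pair; that is the value of \<open>\<omega>\<close>.

  Conversely, a coalition that lowers the outcome from \<open>a\<close> has all its peaks below \<open>a\<close>; compare
  \<open>\<omega>\<close> before and after the deviation at the larger of its largest peak and the new value of \<open>\<omega>\<close>.
  A coalition that raises the outcome from \<open>a\<close> has all its peaks above \<open>a\<close>, so it removes nobody
  from the support of the old value.
\<close>

section \<open>Preferences\<close>

lemma linear_order_onD:
  assumes "linear_order_on X R"
  shows "\<And>x. x \<in> X \<Longrightarrow> (x, x) \<in> R"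
    and "\<And>x y. (x, y) \<in> R \<Longrightarrow> (y, x) \<in> R \<Longrightarrow> x = y"
    and "\<And>x y z. (x, y) \<in> R \<Longrightarrow> (y, z) \<in> R \<Longrightarrow> (x, z) \<in> R"
    and "\<And>x y. x \<in> X \<Longrightarrow> y \<in> X \<Longrightarrow> (x, y) \<in> R \<or> (y, x) \<in> R"
proof -
  have R: "refl_on X R" "antisym R" "trans R" "total_on X R"
    using assms by (simp_all add: order_on_defs)
  show "\<And>x. x \<in> X \<Longrightarrow> (x, x) \<in> R" using R(1) by (rule refl_onD)
  show "\<And>x y. (x, y) \<in> R \<Longrightarrow> (y, x) \<in> R \<Longrightarrow> x = y" using R(2) by (rule antisymD)
  show "\<And>x y z. (x, y) \<in> R \<Longrightarrow> (y, z) \<in> R \<Longrightarrow> (x, z) \<in> R" using R(3) by (rule transD)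
  show "x \<in> X \<Longrightarrow> y \<in> X \<Longrightarrow> (x, y) \<in> R \<or> (y, x) \<in> R" for x y
    using R(1,4) by (cases "x = y") (auto simp: refl_on_def total_on_def)
qed

lemma prefs_linear: "R \<in> prefs X A i \<Longrightarrow> linear_order_on X R"
  by (auto simp: prefs_def single_peaked_def single_dipped_def split: if_splits)

lemma single_dipped_iff_converse: "single_dipped X R \<longleftrightarrow> single_peaked X (R\<inverse>)"
  by (simp add: single_dipped_def single_peaked_def strictly_prefers_def)

section \<open>Preferences that rank one side of a point above the other\<close>

text \<open>
  The parameter \<open>s\<close> is \<open>1\<close> or \<open>-1\<close>; multiplying by it reflects the line, so that statements about
  ``the side of \<open>c\<close> to which \<open>s\<close> points'' cover both directions at once.
\<close>

definition one_sided_peak :: "real set \<Rightarrow> real \<Rightarrow> real \<Rightarrow> real rel" where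
  "one_sided_peak X s c =
     {(u, v) \<in> X \<times> X. if s * c \<le> s * u then s * c \<le> s * v \<longrightarrow> s * u \<le> s * v else s * v \<le> s * u}"

lemma one_sided_peak_single_peaked:
  assumes "c \<in> X" and s: "s = 1 \<or> s = -1"
  shows "single_peaked X (one_sided_peak X s c)"
proof -
  have "linear_order_on X (one_sided_peak X s c)"
    using s unfolding order_on_defs refl_on_def antisym_def trans_def total_on_def
    by (auto simp: one_sided_peak_def split: if_splits)
  moreover have "strictly_prefers (one_sided_peak X s c) x y"
    if "x \<in> X" "y \<in> X" "c \<ge> x \<and> x > y \<or> c \<le> x \<and> x < y" for x y
    using s that by (auto simp: one_sided_peak_def strictly_prefers_def)
  ultimately show ?thesis
    using assms(1) unfolding single_peaked_def by blast
qed

text \<open>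
  The \<open>s\<close>-side of \<open>c\<close> is preferred to the other side; \<open>c\<close> itself is best if \<open>i \<in> A\<close>, worst otherwise.
\<close>

definition one_sided :: "real set \<Rightarrow> nat set \<Rightarrow> nat \<Rightarrow> real \<Rightarrow> real \<Rightarrow> real rel" where
  "one_sided X A i s c =
     (if i \<in> A then one_sided_peak X s c else (one_sided_peak X (- s) c)\<inverse>)"

lemma one_sided_prefs:
  assumes "c \<in> X" and "s = 1 \<or> s = -1"
  shows "one_sided X A i s c \<in> prefs X A i"
proof -
  have "- s = 1 \<or> - s = -1" using assms(2) by auto
  then show ?thesis
    using one_sided_peak_single_peaked[OF assms(1)] assms(2)
    by (simp add: one_sided_def prefs_def single_dipped_iff_converse)
qed

text \<open>The strict \<open>s\<close>-side of \<open>c\<close> is an upper set for a single-dipped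
  agent, whose worst point is \<open>c\<close>. A single-peaked agent may still move onto
  \<open>c\<close>, the best point.\<close>

lemma one_sided_up:
  assumes "(u, z) \<in> one_sided X A i s c" and "s = 1 \<or> s = -1" and "s * z > s * c"
  shows "s * u \<ge> s * c" and "i \<notin> A \<Longrightarrow> s * u > s * c"
  using assms by (auto simp: one_sided_def one_sided_peak_def split: if_splits)

lemma one_sided_weak_up:
  assumes "(u, z) \<in> one_sided X A i s c" and "s = 1 \<or> s = -1" and "s * z \<ge> s * c" and "i \<in> A"
  shows "s * u \<ge> s * c"
  using assms by (auto simp: one_sided_def one_sided_peak_def split: if_splits)

text \<open>Best and worst are taken within \<open>\<Omega>\<close>; the peak or dip in
  \<open>X\<close> may lie outside \<open>\<Omega>\<close> and differ from \<open>c\<close>.\<close>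

definition extremal :: "nat set \<Rightarrow> real set \<Rightarrow> nat \<Rightarrow> real rel \<Rightarrow> real \<Rightarrow> bool" where
  "extremal A \<Omega> i Q c \<longleftrightarrow> (\<forall>u\<in>\<Omega>. if i \<in> A then (c, u) \<in> Q else (u, c) \<in> Q)"

lemma extremal_one_sided:
  assumes "c \<in> \<Omega>" and "\<Omega> \<subseteq> X" and "s = 1 \<or> s = -1"
  shows "extremal A \<Omega> i (one_sided X A i s c) c"
  using assms by (auto simp: extremal_def one_sided_def one_sided_peak_def)

text \<open>The dip \<open>d\<close> differs from \<open>y\<close>, and \<open>s\<close> points from
  \<open>d\<close> towards \<open>y\<close>. \<open>Q'\<close> keeps the dip \<open>d\<close> but
  puts its whole \<open>s\<close>-side first, which can only enlarge the set of outcomes worse than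
  \<open>y\<close>.\<close>

lemma single_dipped_side:
  assumes "Q \<in> prefs X A i" and "i \<notin> A" and "\<not> extremal A \<Omega> i Q y" and "y \<in> \<Omega>" and "\<Omega> \<subseteq> X"
  obtains s Q' where "s = 1 \<or> s = -1" "Q' \<in> prefs X A i"
    and "\<And>w. w \<in> \<Omega> \<Longrightarrow> (y, w) \<in> Q \<Longrightarrow> s * w \<le> s * y"
    and "\<And>w. w \<in> \<Omega> \<Longrightarrow> (y, w) \<in> Q \<Longrightarrow> (y, w) \<in> Q'"
    and "\<And>u z. (u, z) \<in> Q' \<Longrightarrow> s * z > s * y \<Longrightarrow> s * u > s * y"
proof -
  have lin: "linear_order_on X Q" by (rule prefs_linear[OF assms(1)])
  obtain d where d: "d \<in> X"
    and dip: "\<And>x y. x \<in> X \<Longrightarrow> y \<in> X \<Longrightarrow> d \<ge> x \<and> x > y \<or> d \<le> x \<and> x < y \<Longrightarrow> strictly_prefers Q y x"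
    using assms(1,2) by (auto simp: prefs_def single_dipped_def)
  have "d \<noteq> y"
  proof
    assume "d = y"
    then have "(u, y) \<in> Q" if "u \<in> \<Omega>" for u
      using dip[of y u] that subsetD[OF assms(5)] assms(4) linear_order_onD(1)[OF lin, of u]
      by (cases "u = y") (auto simp: strictly_prefers_def neq_iff)
    then show False using assms(2,3) by (auto simp: extremal_def)
  qed
  define s :: real where "s = (if d < y then 1 else -1)"
  have s: "s = 1 \<or> s = -1" by (simp add: s_def)
  have w: "s * w \<le> s * y" if "w \<in> \<Omega>" "(y, w) \<in> Q" for w
  proof (rule ccontr)
    assume "\<not> s * w \<le> s * y"
    then have "strictly_prefers Q w y"
      using dip[of y w] that(1) assms(4,5) \<open>d \<noteq> y\<close> by (auto simp: s_def split: if_splits)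
    then show False using that(2) by (simp add: strictly_prefers_def)
  qed
  show ?thesis
  proof (rule that[OF s one_sided_prefs[OF d s]])
    fix w assume "w \<in> \<Omega>" "(y, w) \<in> Q"
    then show "(y, w) \<in> one_sided X A i s d"
      using w[of w] assms(2,4,5) \<open>d \<noteq> y\<close>
      by (auto simp: one_sided_def one_sided_peak_def s_def split: if_splits)
  next
    fix u z assume "(u, z) \<in> one_sided X A i s d" "s * z > s * y"
    then show "s * u > s * y"
      using assms(2) \<open>d \<noteq> y\<close>
      by (auto simp: one_sided_def one_sided_peak_def s_def split: if_splits)
  qed (rule w)
qed

section \<open>Best elements of a closed range\<close>

lemma best_props:
  assumes sp: "single_peaked X R" and "\<Omega> \<subseteq> X" and "closed \<Omega>" and "\<Omega> \<noteq> {}"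
  shows "best \<Omega> R \<in> \<Omega>" and "\<And>y. y \<in> \<Omega> \<Longrightarrow> (best \<Omega> R, y) \<in> R"
proof -
  have lin: "linear_order_on X R" using sp by (simp add: single_peaked_def)
  note lo = linear_order_onD[OF lin]
  obtain r where r: "r \<in> X"
    and pk: "\<And>x y. x \<in> X \<Longrightarrow> y \<in> X \<Longrightarrow> r \<ge> x \<and> x > y \<or> r \<le> x \<and> x < y \<Longrightarrow> strictly_prefers R x y"
    using sp by (auto simp: single_peaked_def)
  \<comment> \<open>Closedness gives a point of \<open>\<Omega>\<close> nearest to the peak
    \<open>r\<close> from the left. \<open>right\<close> is the mirror image, and the better of the
    two candidates is best.\<close>
  have left: "\<exists>a\<in>\<Omega>. a \<le> r \<and> (\<forall>y\<in>\<Omega>. y \<le> r \<longrightarrow> (a, y) \<in> R)" if "\<exists>y\<in>\<Omega>. y \<le> r"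
  proof -
    let ?S = "\<Omega> \<inter> {..r}"
    have "closed ?S" "?S \<noteq> {}" "bdd_above ?S" using assms(3) that by auto
    then obtain a where a: "a \<in> ?S" "\<And>y. y \<in> ?S \<Longrightarrow> y \<le> a"
      using closed_contains_Sup[of ?S] cSup_upper[of _ ?S] by metis
    have "(a, y) \<in> R" if "y \<in> \<Omega>" "y \<le> r" for y
      using pk[of a y] a(2)[of y] a(1) that assms(2) lo(1)[of y]
      by (cases "a = y") (auto simp: strictly_prefers_def)
    then show ?thesis using a(1) by blast
  qed
  have right: "\<exists>a\<in>\<Omega>. r \<le> a \<and> (\<forall>y\<in>\<Omega>. r \<le> y \<longrightarrow> (a, y) \<in> R)" if "\<exists>y\<in>\<Omega>. r \<le> y"
  proof -
    let ?S = "\<Omega> \<inter> {r..}"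
    have "closed ?S" "?S \<noteq> {}" "bdd_below ?S" using assms(3) that by auto
    then obtain a where a: "a \<in> ?S" "\<And>y. y \<in> ?S \<Longrightarrow> a \<le> y"
      using closed_contains_Inf[of ?S] cInf_lower[of _ ?S] by metis
    have "(a, y) \<in> R" if "y \<in> \<Omega>" "r \<le> y" for y
      using pk[of a y] a(2)[of y] a(1) that assms(2) lo(1)[of y]
      by (cases "a = y") (auto simp: strictly_prefers_def)
    then show ?thesis using a(1) by blast
  qed
  have "\<exists>x. x \<in> \<Omega> \<and> (\<forall>y\<in>\<Omega>. (x, y) \<in> R)"
  proof (cases "(\<exists>y\<in>\<Omega>. y \<le> r) \<and> (\<exists>y\<in>\<Omega>. r \<le> y)")
    case True
    with left right obtain a b where a: "a \<in> \<Omega>" "\<And>y. y \<in> \<Omega> \<Longrightarrow> y \<le> r \<Longrightarrow> (a, y) \<in> R"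
      and b: "b \<in> \<Omega>" "\<And>y. y \<in> \<Omega> \<Longrightarrow> r \<le> y \<Longrightarrow> (b, y) \<in> R"
      by blast
    have "(a, y) \<in> R \<or> (b, y) \<in> R" if "y \<in> \<Omega>" for y
      using a(2)[OF that] b(2)[OF that] by linarith
    moreover have "(a, b) \<in> R \<or> (b, a) \<in> R" using lo(4) a(1) b(1) assms(2) by blast
    ultimately show ?thesis using a(1) b(1) lo(3)[of a b] lo(3)[of b a] by blast
  next
    case False
    then have "(\<forall>y\<in>\<Omega>. y \<le> r) \<or> (\<forall>y\<in>\<Omega>. r \<le> y)" by force
    then show ?thesis using left right assms(4) by blast
  qed
  then have "\<exists>!x. x \<in> \<Omega> \<and> (\<forall>y\<in>\<Omega>. (x, y) \<in> R)" using lo(2) by blast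
  then have "best \<Omega> R \<in> \<Omega> \<and> (\<forall>y\<in>\<Omega>. (best \<Omega> R, y) \<in> R)"
    unfolding best_def by (rule theI')
  then show "best \<Omega> R \<in> \<Omega>" "\<And>y. y \<in> \<Omega> \<Longrightarrow> (best \<Omega> R, y) \<in> R"
    by blast+
qed

lemma best_eqI:
  assumes "linear_order_on X R" "x \<in> \<Omega>" "\<And>y. y \<in> \<Omega> \<Longrightarrow> (x, y) \<in> R"
  shows "best \<Omega> R = x"
  unfolding best_def
proof (rule the_equality)
  fix z assume "z \<in> \<Omega> \<and> (\<forall>y\<in>\<Omega>. (z, y) \<in> R)"
  then show "z = x" using linear_order_onD(2)[OF assms(1), of z x] assms(2,3) by blast
qed (use assms(2,3) in blast)

text \<open>Single-peakedness is given around the peak \<open>r\<close> in \<open>X\<close>, not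
  around the best element of \<open>\<Omega>\<close>. If \<open>u\<close> is not that element, then
  \<open>r\<close> cannot lie at or beyond \<open>u\<close> as seen from it, since \<open>u\<close>
  would then be better; so \<open>u\<close> lies between \<open>r\<close> and
  \<open>v\<close>.\<close>

lemma best_single_peaked:
  assumes sp: "single_peaked X R" and "\<Omega> \<subseteq> X" "closed \<Omega>"
    and uv: "u \<in> \<Omega>" "v \<in> \<Omega>" "best \<Omega> R \<le> u \<and> u < v \<or> best \<Omega> R \<ge> u \<and> u > v"
  shows "strictly_prefers R u v"
proof -
  have lin: "linear_order_on X R" using sp by (simp add: single_peaked_def)
  note lo = linear_order_onD[OF lin]
  have "\<Omega> \<noteq> {}" using uv by auto
  note b = best_props[OF sp assms(2,3) this]
  obtain r where r: "r \<in> X"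
    and pk: "\<And>x y. x \<in> X \<Longrightarrow> y \<in> X \<Longrightarrow> r \<ge> x \<and> x > y \<or> r \<le> x \<and> x < y \<Longrightarrow> strictly_prefers R x y"
    using sp by (auto simp: single_peaked_def)
  show ?thesis
  proof (cases "best \<Omega> R = u")
    case True
    then show ?thesis using b(2)[OF uv(2)] uv(3) lo(2) by (force simp: strictly_prefers_def)
  next
    case False
    have "\<not> strictly_prefers R u (best \<Omega> R)" using b(2)[OF uv(1)] by (simp add: strictly_prefers_def)
    moreover have "u \<in> X" "v \<in> X" "best \<Omega> R \<in> X" using assms(2) b(1) uv by auto
    ultimately show ?thesis using False uv(3) pk[of u "best \<Omega> R"] pk[of u v] by fastforce
  qed
qed

section \<open>Strategy-proof rules\<close>

text \<open>Strategy-proofness is left to an extension, so that the same context serves the converse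
  direction.\<close>

locale voting_rule =
  fixes X \<Omega> :: "real set" and A D :: "nat set" and f :: "(nat \<Rightarrow> real rel) \<Rightarrow> real"
  assumes finite_agents: "finite (A \<union> D)"
    and disjoint: "A \<inter> D = {}"
    and maps: "f \<in> profiles X A D \<rightarrow> X"
    and range: "f ` profiles X A D = \<Omega>"
    and closed_range: "closed \<Omega>"
    and two_outcomes: "\<exists>u\<in>\<Omega>. \<exists>v\<in>\<Omega>. u < v"
begin

lemma range_subset: "\<Omega> \<subseteq> X" and range_nonempty: "\<Omega> \<noteq> {}"
  using maps range two_outcomes by auto

lemma outcome: "R \<in> profiles X A D \<Longrightarrow> f R \<in> \<Omega>"
  using range by auto

lemma profile_pref: "R \<in> profiles X A D \<Longrightarrow> i \<in> A \<union> D \<Longrightarrow> R i \<in> prefs X A i"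
  by (auto simp: profiles_def)

lemma profile_linear: "R \<in> profiles X A D \<Longrightarrow> i \<in> A \<union> D \<Longrightarrow> linear_order_on X (R i)"
  by (rule prefs_linear[OF profile_pref])

lemma profile_single_peaked: "R \<in> profiles X A D \<Longrightarrow> i \<in> A \<Longrightarrow> single_peaked X (R i)"
  using profile_pref[of R i] by (auto simp: prefs_def)

lemma profile_upd:
  assumes "R \<in> profiles X A D" "i \<in> A \<union> D" "Q \<in> prefs X A i"
  shows "R(i := Q) \<in> profiles X A D"
  using assms by (auto simp: profiles_def PiE_def extensional_def)

lemma profile_restrict:
  assumes "\<And>i. i \<in> A \<union> D \<Longrightarrow> R i \<in> prefs X A i"
  shows "restrict R (A \<union> D) \<in> profiles X A D"
  using assms by (simp add: profiles_def)

lemma one_sided_pref: "c \<in> \<Omega> \<Longrightarrow> s = 1 \<or> s = -1 \<Longrightarrow> one_sided X A i s c \<in> prefs X A i"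
  using one_sided_prefs range_subset by blast

text \<open>Induction on the set \<open>S\<close> of agents who have already switched. The step may
  use \<open>T i = R i\<close> because the agent about to switch still has the old preference;
  extensionality makes the end of the walk exactly \<open>R'\<close>.\<close>

lemma profile_walk:
  assumes R: "R \<in> profiles X A D" and R': "R' \<in> profiles X A D" and "P R"
    and step: "\<And>T i. T \<in> profiles X A D \<Longrightarrow> P T \<Longrightarrow> i \<in> A \<union> D \<Longrightarrow> T i = R i \<Longrightarrow> P (T(i := R' i))"
  shows "P R'"
proof -
  have "override_on R R' S \<in> profiles X A D \<and> P (override_on R R' S)" if "S \<subseteq> A \<union> D" for S
    using finite_subset[OF that finite_agents] that
  proof (induction S rule: finite_induct)
    case empty
    then show ?case using R \<open>P R\<close> by (simp add: override_on_emptyset)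
  next
    case (insert i S)
    let ?T = "override_on R R' S"
    have T: "?T \<in> profiles X A D" "P ?T" "i \<in> A \<union> D" "?T i = R i"
      using insert by (auto simp: override_on_def)
    have eq: "override_on R R' (insert i S) = ?T(i := R' i)"
      by (rule override_on_insert)
    show ?case
      unfolding eq using step[OF T] profile_upd[OF T(1,3) profile_pref[OF R' T(3)]] by blast
  qed
  from this[of "A \<union> D"] have "P (override_on R R' (A \<union> D))" by simp
  moreover have "override_on R R' (A \<union> D) = R'"
  proof
    fix j show "override_on R R' (A \<union> D) j = R' j"
      using PiE_arb[OF R[unfolded profiles_def], of j] PiE_arb[OF R'[unfolded profiles_def], of j]
      by (cases "j \<in> A \<union> D") auto
  qed
  ultimately show ?thesis by simp
qed

lemma peak_mem: "R \<in> profiles X A D \<Longrightarrow> i \<in> A \<Longrightarrow> best \<Omega> (R i) \<in> \<Omega>"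
  using best_props(1) profile_single_peaked range_subset closed_range range_nonempty by blast

lemma peak_best: "R \<in> profiles X A D \<Longrightarrow> i \<in> A \<Longrightarrow> y \<in> \<Omega> \<Longrightarrow> (best \<Omega> (R i), y) \<in> R i"
  using best_props(2) profile_single_peaked range_subset closed_range range_nonempty by blast

lemma peak_towards:
  assumes "R \<in> profiles X A D" "i \<in> A" "u \<in> \<Omega>" "v \<in> \<Omega>" "(v, u) \<in> R i"
  shows "u < v \<Longrightarrow> u < best \<Omega> (R i)" and "v < u \<Longrightarrow> best \<Omega> (R i) < u"
  using best_single_peaked[OF profile_single_peaked[OF assms(1,2)] range_subset closed_range assms(3,4)]
    assms(5)
  by (auto simp: strictly_prefers_def not_less[symmetric])

lemma best_one_sided:
  assumes "c \<in> \<Omega>" "i \<in> A" "s = 1 \<or> s = -1"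
  shows "best \<Omega> (one_sided X A i s c) = c"
  using extremal_one_sided[OF assms(1) range_subset assms(3), of A i] assms(1,2)
  by (intro best_eqI[OF prefs_linear[OF one_sided_pref[OF assms(1,3)]]]) (auto simp: extremal_def)

end

section \<open>Maskin monotonicity and unanimity at interior outcomes\<close>

locale strategy_proof_rule = voting_rule +
  assumes strategy_proof: "strategy_proof X A D f"
begin

lemma truthful:
  assumes "R \<in> profiles X A D" "i \<in> A \<union> D" "Q \<in> prefs X A i"
  shows "(f R, f (R(i := Q))) \<in> R i"
proof (rule ccontr)
  assume n: "(f R, f (R(i := Q))) \<notin> R i"
  let ?R' = "\<lambda>j\<in>{i}. Q"
  have eq: "override_on R ?R' {i} = R(i := Q)" by (simp add: override_on_def fun_eq_iff)
  have "f R \<in> X" "f (R(i := Q)) \<in> X"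
    using outcome[OF assms(1)] outcome[OF profile_upd[OF assms]] range_subset by auto
  then have "strictly_prefers (R i) (f (override_on R ?R' {i})) (f R)"
    using n linear_order_onD(4)[OF profile_linear[OF assms(1,2)]]
    by (auto simp: eq strictly_prefers_def)
  moreover have "?R' \<in> (\<Pi>\<^sub>E j\<in>{i}. prefs X A j)" using assms(3) by simp
  ultimately have "manipulable_by X A D f {i}"
    using assms(1) unfolding manipulable_by_def by blast
  then show False using strategy_proof assms(2) by (auto simp: strategy_proof_def)
qed

text \<open>This is \<open>truthful\<close> at the changed profile, with the old preference as the
  deviation.\<close>

lemma truthful':
  assumes "R \<in> profiles X A D" "i \<in> A \<union> D" "Q \<in> prefs X A i"
  shows "(f (R(i := Q)), f R) \<in> Q"
  using truthful[OF profile_upd[OF assms] assms(2) profile_pref[OF assms(1,2)]] by simp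

text \<open>Switch one agent at a time. The old outcome is weakly better than the new one under the
  old preference, hence under the new one too; \<open>truthful'\<close> gives the reverse, and
  antisymmetry gives equality.\<close>

lemma maskin_monotone:
  assumes "R \<in> profiles X A D" "R' \<in> profiles X A D"
    and "\<And>i w. i \<in> A \<union> D \<Longrightarrow> w \<in> \<Omega> \<Longrightarrow> (f R, w) \<in> R i \<Longrightarrow> (f R, w) \<in> R' i"
  shows "f R' = f R"
proof (rule profile_walk[OF assms(1,2), where P = "\<lambda>T. f T = f R"])
  fix T i
  assume T: "T \<in> profiles X A D" "f T = f R" "i \<in> A \<union> D" "T i = R i"
  note Q = profile_pref[OF assms(2) T(3)]
  have "(f R, f (T(i := R' i))) \<in> R' i"
    using assms(3)[OF T(3) outcome[OF profile_upd[OF T(1,3) Q]]] truthful[OF T(1,3) Q] T(2,4) by simp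
  with truthful'[OF T(1,3) Q] show "f (T(i := R' i)) = f R"
    using linear_order_onD(2)[OF prefs_linear[OF Q]] T(2) by auto
qed simp

text \<open>By \<open>truthful'\<close> a switch leads to an outcome weakly better under the new
  preference, so it cannot leave an upper set of that preference.\<close>

lemma outcome_stays_in:
  assumes "R \<in> profiles X A D" "R' \<in> profiles X A D" "f R \<in> Z"
    and "\<And>i u z. i \<in> A \<union> D \<Longrightarrow> R' i \<noteq> R i \<Longrightarrow> u \<in> \<Omega> \<Longrightarrow> z \<in> Z \<Longrightarrow> (u, z) \<in> R' i \<Longrightarrow> u \<in> Z"
  shows "f R' \<in> Z"
proof (rule profile_walk[OF assms(1,2), where P = "\<lambda>T. f T \<in> Z"])
  fix T i
  assume T: "T \<in> profiles X A D" "f T \<in> Z" "i \<in> A \<union> D" "T i = R i"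
  note Q = profile_pref[OF assms(2) T(3)]
  show "f (T(i := R' i)) \<in> Z"
  proof (cases "R' i = R i")
    case True
    then have "T(i := R' i) = T" using T(4) by (metis fun_upd_triv)
    then show ?thesis using T(2) by simp
  next
    case False
    then show ?thesis
      using assms(4)[OF T(3) False outcome[OF profile_upd[OF T(1,3) Q]] T(2) truthful'[OF T(1,3) Q]]
      by simp
  qed
qed (rule assms(3))

text \<open>
  Take a profile with outcome \<open>y\<close> for which \<open>y\<close> is not worst for as few single-dipped agents as
  possible. By minimality each such agent moves the outcome off \<open>y\<close> when she reports \<open>y\<close> as her dip.
  Two of them with dips on opposite sides of \<open>y\<close> contradict each other; if all dips lie on the same
  side, Maskin monotonicity makes all of them rank the other side first, which then gets chosen.
\<close>

lemma unanimous_interior: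
  assumes y: "y \<in> \<Omega>" and below: "x \<in> \<Omega>" "x < y" and above: "z \<in> \<Omega>" "y < z"
    and R: "R \<in> profiles X A D" and top: "\<And>i. i \<in> A \<Longrightarrow> extremal A \<Omega> i (R i) y"
  shows "f R = y"
proof -
  define good where "good T \<longleftrightarrow> T \<in> profiles X A D \<and> f T = y \<and> (\<forall>i\<in>A. extremal A \<Omega> i (T i) y)" for T
  define K where "K T = {i \<in> D. \<not> extremal A \<Omega> i (T i) y}" for T
  note os = one_sided_pref[OF y] extremal_one_sided[OF y range_subset]
  have DA: "i \<notin> A" if "i \<in> D" for i using disjoint that by auto
  have finK: "finite (K T)" for T using finite_agents by (simp add: K_def)
  obtain T0 where T0: "T0 \<in> profiles X A D" "f T0 = y" using y range by auto
  \<comment> \<open>Maskin monotonicity lets all single-peaked agents move their peaks to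
    \<open>y\<close> while the outcome stays \<open>y\<close>, so good profiles exist.\<close>
  let ?T1 = "restrict (\<lambda>i. if i \<in> A then one_sided X A i 1 y else T0 i) (A \<union> D)"
  have T1: "?T1 \<in> profiles X A D"
    by (rule profile_restrict) (use os(1)[of 1] profile_pref[OF T0(1)] in auto)
  have "f ?T1 = f T0"
    by (rule maskin_monotone[OF T0(1) T1]) (use T0(2) os(2)[of 1] in \<open>auto simp: extremal_def\<close>)
  then have "good ?T1" using T0(2) T1 os(2)[of 1] by (auto simp: good_def)
  then obtain T where T: "good T" and least: "\<And>T'. good T' \<Longrightarrow> card (K T) \<le> card (K T')"
    using ex_has_least_nat[of good ?T1 "\<lambda>T. card (K T)"] by blast
  have Tp: "T \<in> profiles X A D" and fT: "f T = y" and Ttop: "\<And>i. i \<in> A \<Longrightarrow> extremal A \<Omega> i (T i) y"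
    using T by (auto simp: good_def)
  show ?thesis
  proof (cases "K T = {}")
    case True
    have "f R = f T"
    proof (rule maskin_monotone[OF Tp R])
      fix i w assume i: "i \<in> A \<union> D" and w: "w \<in> \<Omega>" "(f T, w) \<in> T i"
      show "(f T, w) \<in> R i"
      proof (cases "i \<in> A")
        case True
        then show ?thesis using top[OF True] w fT by (auto simp: extremal_def)
      next
        case False
        then have "(w, y) \<in> T i" using \<open>K T = {}\<close> i w(1) by (auto simp: K_def extremal_def)
        then have "w = y" using linear_order_onD(2)[OF profile_linear[OF Tp i]] w(2) fT by auto
        then show ?thesis
          using linear_order_onD(1)[OF profile_linear[OF R i]] fT y range_subset by auto
      qed
    qed
    then show ?thesis using fT by simp
  next
    case False
    define side where "side i s Q \<longleftrightarrow> (s = 1 \<or> s = -1) \<and> Q \<in> prefs X A i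
        \<and> (\<forall>w\<in>\<Omega>. (y, w) \<in> T i \<longrightarrow> s * w \<le> s * y) \<and> (\<forall>w\<in>\<Omega>. (y, w) \<in> T i \<longrightarrow> (y, w) \<in> Q)
        \<and> (\<forall>u z. (u, z) \<in> Q \<longrightarrow> s * z > s * y \<longrightarrow> s * u > s * y)" for i and s :: real and Q
    have "\<exists>s Q. side i s Q" if "i \<in> K T" for i
    proof -
      have i: "i \<in> D" "\<not> extremal A \<Omega> i (T i) y" using that by (auto simp: K_def)
      have Ti: "T i \<in> prefs X A i" using profile_pref[OF Tp] i(1) by blast
      show ?thesis
      proof (rule single_dipped_side[OF Ti DA[OF i(1)] i(2) y range_subset])
        fix s Q
        assume "s = 1 \<or> s = -1" "Q \<in> prefs X A i"
          "\<And>w. w \<in> \<Omega> \<Longrightarrow> (y, w) \<in> T i \<Longrightarrow> s * w \<le> s * y"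
          "\<And>w. w \<in> \<Omega> \<Longrightarrow> (y, w) \<in> T i \<Longrightarrow> (y, w) \<in> Q"
          "\<And>u z. (u, z) \<in> Q \<Longrightarrow> s * z > s * y \<Longrightarrow> s * u > s * y"
        then have "side i s Q" unfolding side_def by blast
        then show ?thesis by blast
      qed
    qed
    then obtain s Q where sQ: "\<And>i. i \<in> K T \<Longrightarrow> side i (s i) (Q i)"
      by metis
    have s: "s i = 1 \<or> s i = -1" and Q: "Q i \<in> prefs X A i"
      and sw: "\<And>w. w \<in> \<Omega> \<Longrightarrow> (y, w) \<in> T i \<Longrightarrow> s i * w \<le> s i * y"
      and Qw: "\<And>w. w \<in> \<Omega> \<Longrightarrow> (y, w) \<in> T i \<Longrightarrow> (y, w) \<in> Q i"
      and Qu: "\<And>u z. (u, z) \<in> Q i \<Longrightarrow> s i * z > s i * y \<Longrightarrow> s i * u > s i * y"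
      if "i \<in> K T" for i
      using sQ[OF that] unfolding side_def by blast+
    define U where "U i = one_sided X A i (s i) y" for i
    have KD: "i \<in> D" "i \<in> A \<union> D" "i \<notin> A" if "i \<in> K T" for i
      using that DA by (auto simp: K_def)
    have U: "U i \<in> prefs X A i" if "i \<in> K T" for i using os(1)[OF s[OF that]] by (simp add: U_def)
    \<comment> \<open>\<open>U i\<close> makes \<open>y\<close> worst for \<open>i\<close>, so
      outcome \<open>y\<close> would contradict the choice of \<open>T\<close>; truthfulness under
      \<open>T i\<close> excludes the \<open>s i\<close>-side.\<close>
    have drop: "s i * f (T(i := U i)) < s i * y" if i: "i \<in> K T" for i
    proof -
      let ?T = "T(i := U i)"
      have Tp': "?T \<in> profiles X A D" by (rule profile_upd[OF Tp KD(2)[OF i] U[OF i]])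
      have "f ?T \<noteq> y"
      proof
        assume "f ?T = y"
        then have "good ?T" using Tp' Ttop KD(3)[OF i] by (auto simp: good_def)
        moreover have "K ?T \<subseteq> K T - {i}" using os(2)[OF s[OF i]] by (auto simp: K_def U_def)
        then have "card (K ?T) < card (K T)" using i finK[of T] by (intro psubset_card_mono) auto
        ultimately show False using least[of ?T] by simp
      qed
      moreover have "s i * f ?T \<le> s i * y"
        using sw[OF i outcome[OF Tp']] truthful[OF Tp KD(2)[OF i] U[OF i]] fT by simp
      ultimately show ?thesis using s[OF i] by auto
    qed
    \<comment> \<open>With opposite signs, each agent alone pushes the outcome to the side favoured
      by the other's report. After both reports it would lie strictly on both sides of
      \<open>y\<close>.\<close>
    have same: "s i = s j" if ij: "i \<in> K T" "j \<in> K T" for i j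
    proof (rule ccontr)
      assume ne: "s i \<noteq> s j"
      then have "i \<noteq> j" by auto
      let ?G = "T(i := U i, j := U j)"
      have Tp': "T(i := U i) \<in> profiles X A D" "T(j := U j) \<in> profiles X A D"
        using profile_upd[OF Tp KD(2) U] ij by auto
      have sj: "s j = - s i" using s[OF ij(1)] s[OF ij(2)] ne by auto
      have "(f ?G, f (T(j := U j))) \<in> U i"
        using truthful'[OF Tp'(2) KD(2)[OF ij(1)] U[OF ij(1)]] \<open>i \<noteq> j\<close> by (simp add: fun_upd_twist)
      then have "s i * f ?G > s i * y"
        using one_sided_up(2)[OF _ s[OF ij(1)] _ KD(3)[OF ij(1)]] drop[OF ij(2)] sj
        by (auto simp: U_def)
      moreover have "(f ?G, f (T(i := U i))) \<in> U j"
        using truthful'[OF Tp'(1) KD(2)[OF ij(2)] U[OF ij(2)]] by simp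
      then have "s j * f ?G > s j * y"
        using one_sided_up(2)[OF _ s[OF ij(2)] _ KD(3)[OF ij(2)]] drop[OF ij(1)] sj
        by (auto simp: U_def)
      ultimately show False using sj by simp
    qed
    obtain k where k: "k \<in> K T" using False by auto
    define t where "t = s k"
    have t: "t = 1 \<or> t = -1" and st: "\<And>i. i \<in> K T \<Longrightarrow> s i = t"
      using s[OF k] same[OF _ k] by (auto simp: t_def)
    let ?V = "restrict (\<lambda>i. one_sided X A i t y) (A \<union> D)"
    let ?W = "restrict (\<lambda>i. if i \<in> K T then Q i else one_sided X A i t y) (A \<union> D)"
    have Vp: "?V \<in> profiles X A D" by (rule profile_restrict) (rule os(1)[OF t])
    have Wp: "?W \<in> profiles X A D" by (rule profile_restrict) (use os(1)[OF t] Q in auto)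
    have "f ?W = f T"
    proof (rule maskin_monotone[OF Tp Wp])
      fix i w assume i: "i \<in> A \<union> D" and w: "w \<in> \<Omega>" "(f T, w) \<in> T i"
      consider "i \<in> K T" | "i \<in> A" | "i \<in> D" "i \<notin> K T" using i by auto
      then show "(f T, w) \<in> ?W i"
      proof cases
        case 1
        then show ?thesis using Qw[OF 1 w(1)] w(2) fT i by simp
      next
        case 2
        then have "i \<notin> K T" using KD(3) by blast
        then show ?thesis using os(2)[OF t, of A i] 2 w(1) fT by (auto simp: extremal_def)
      next
        case 3
        then have "(w, y) \<in> T i" using w(1) DA by (auto simp: K_def extremal_def)
        then have "w = y" using linear_order_onD(2)[OF profile_linear[OF Tp i]] w(2) fT by auto
        then show ?thesis
          using linear_order_onD(1)[OF profile_linear[OF Wp i]] fT y range_subset by auto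
      qed
    qed
    then have W: "f ?W = y" using fT by simp
    have "f ?V \<noteq> y"
    proof
      assume "f ?V = y"
      then have "good ?V" using Vp os(2)[OF t] by (auto simp: good_def)
      moreover have "K ?V = {}" using os(2)[OF t] by (auto simp: K_def)
      ultimately show False using least[of ?V] False finK by simp
    qed
    moreover have "t * f ?V \<ge> t * y"
    proof -
      obtain z' where z': "z' \<in> \<Omega>" "t * z' > t * y" using below above t by auto
      then obtain Rz where Rz: "Rz \<in> profiles X A D" "f Rz = z'" using range by auto
      \<comment> \<open>The single-dipped agents switch first, while the outcome is strictly on the
        \<open>t\<close>-side; the switch of the single-peaked agents preserves only the weak
        \<open>t\<close>-side.\<close>
      let ?R1 = "restrict (\<lambda>i. if i \<in> A then Rz i else one_sided X A i t y) (A \<union> D)"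
      have R1: "?R1 \<in> profiles X A D"
        by (rule profile_restrict) (use os(1)[OF t] profile_pref[OF Rz(1)] in auto)
      have "f ?R1 \<in> {u. t * u > t * y}"
        by (rule outcome_stays_in[OF Rz(1) R1])
          (use z' Rz(2) one_sided_up(2)[OF _ t] in \<open>auto split: if_splits\<close>)
      then have "f ?R1 \<in> {u. t * u \<ge> t * y}" by auto
      then have "f ?V \<in> {u. t * u \<ge> t * y}"
        by (rule outcome_stays_in[OF R1 Vp])
          (use one_sided_weak_up[OF _ t] in \<open>auto split: if_splits\<close>)
      then show ?thesis by simp
    qed
    ultimately have "f ?V \<in> {u. t * u > t * y}" using t by auto
    \<comment> \<open>Only agents in \<open>K T\<close> differ between \<open>?V\<close> and
      \<open>?W\<close>, and \<open>Q i\<close> has the strict \<open>t\<close>-side of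
      \<open>y\<close> as an upper set.\<close>
    then have "f ?W \<in> {u. t * u > t * y}"
      by (rule outcome_stays_in[OF Vp Wp]) (use Qu st in \<open>auto split: if_splits\<close>)
    then show ?thesis using W by simp
  qed
qed

text \<open>A single-dipped agent whose worst outcome \<open>y\<close> is chosen ranks no other
  outcome below it, so every report passes Maskin monotonicity. For a single-peaked agent
  \<open>y\<close> must be best again.\<close>

lemma extremal_stays:
  assumes R: "R \<in> profiles X A D" and i: "i \<in> A \<union> D" and Q: "Q \<in> prefs X A i"
    and "extremal A \<Omega> i (R i) y" and "i \<in> A \<Longrightarrow> extremal A \<Omega> i Q y" and fR: "f R = y"
  shows "f (R(i := Q)) = y"
proof -
  have "f (R(i := Q)) = f R"
  proof (rule maskin_monotone[OF R profile_upd[OF R i Q]])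
    fix j w assume j: "j \<in> A \<union> D" and w: "w \<in> \<Omega>" "(f R, w) \<in> R j"
    show "(f R, w) \<in> (R(i := Q)) j"
    proof (cases "j = i \<and> i \<notin> A")
      case True
      then have "(w, y) \<in> R i" using assms(4) w(1) by (auto simp: extremal_def)
      then have "w = y" using linear_order_onD(2)[OF profile_linear[OF R i]] w(2) True fR by auto
      then show ?thesis
        using linear_order_onD(1)[OF prefs_linear[OF Q]] outcome[OF R] range_subset True fR by auto
    next
      case False
      then show ?thesis using w fR assms(5) by (auto simp: extremal_def)
    qed
  qed
  then show ?thesis using fR by simp
qed

section \<open>Option sets of a single agent\<close>

text \<open>
  Converting the other agents one by one to preferences with extremal point \<open>y\<close> either keeps the agent
  pivotal or makes the converted agent pivotal, and ends in a contradiction to unanimity.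
\<close>

lemma no_jump:
  assumes y: "y \<in> \<Omega>" and below: "x \<in> \<Omega>" "x < y" and above: "z \<in> \<Omega>" "y < z"
  shows "R \<in> profiles X A D \<Longrightarrow> i \<in> A \<union> D \<Longrightarrow> f (R(i := one_sided X A i (-1) y)) < y \<Longrightarrow>
    y < f (R(i := one_sided X A i 1 y)) \<Longrightarrow> False"
\<comment> \<open>The measure counts the other agents for whom \<open>y\<close> is not extremal. The
  pivotal agent is generalized because the role may pass from \<open>i\<close> to
  \<open>j\<close>.\<close>
proof (induction "card {j \<in> A \<union> D - {i}. \<not> extremal A \<Omega> j (R j) y}" arbitrary: i R
    rule: less_induct)
  case less
  note R = less.prems(1) and i = less.prems(2)
  define K where "K k T = {j \<in> A \<union> D - {k}. \<not> extremal A \<Omega> j (T j) y}" for k and T :: "nat \<Rightarrow> real rel"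
  have finK: "finite (K k T)" for k T using finite_agents by (simp add: K_def)
  define L U where "L j = one_sided X A j (-1) y" and "U j = one_sided X A j 1 y" for j
  have LU: "L j \<in> prefs X A j" "U j \<in> prefs X A j" for j
    using one_sided_pref[OF y] by (auto simp: L_def U_def)
  have ext: "extremal A \<Omega> j (L j) y" "extremal A \<Omega> j (U j) y" for j
    using extremal_one_sided[OF y range_subset] by (auto simp: L_def U_def)
  have L: "f (R(i := L i)) < y" and U: "y < f (R(i := U i))"
    using less.prems(3,4) by (auto simp: L_def U_def)
  show ?case
  proof (cases "K i R = {}")
    case True
    have "f (R(i := U i)) = y"
    proof (rule unanimous_interior[OF y below above profile_upd[OF R i LU(2)]])
      fix j assume "j \<in> A"
      then show "extremal A \<Omega> j ((R(i := U i)) j) y" using True ext by (auto simp: K_def)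
    qed
    then show False using U by simp
  next
    case False
    then obtain j where j: "j \<in> A \<union> D" "j \<noteq> i" "\<not> extremal A \<Omega> j (R j) y" by (auto simp: K_def)
    define F where "F a b = f (R(i := a, j := b))" for a b
    have prof: "R(i := a) \<in> profiles X A D" "R(i := a, j := b) \<in> profiles X A D"
      if "a \<in> prefs X A i" "b \<in> prefs X A j" for a b
      using profile_upd R i j(1) that by blast+
    have F1: "F a (R j) = f (R(i := a))" for a
      unfolding F_def using j(2) by (metis fun_upd_other fun_upd_triv)
    have Rj: "R j \<in> prefs X A j" by (rule profile_pref[OF R j(1)])
    have swap: "F a b \<noteq> y" if "F a' b \<noteq> y" "a \<in> {L i, U i}" "a' \<in> {L i, U i}" "b \<in> prefs X A j" for a a' b
    proof
      assume "F a b = y"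
      have aa: "a \<in> prefs X A i" "a' \<in> prefs X A i" "extremal A \<Omega> i a y" "extremal A \<Omega> i a' y"
        using that(2,3) LU ext by auto
      have "f ((R(i := a, j := b))(i := a')) = y"
        by (rule extremal_stays[OF prof(2)[OF aa(1) that(4)] i aa(2)])
          (use aa j(2) \<open>F a b = y\<close> in \<open>auto simp: F_def\<close>)
      moreover have "(R(i := a, j := b))(i := a') = R(i := a', j := b)" using j(2) by (simp add: fun_eq_iff)
      ultimately show False using that(1) by (simp add: F_def)
    qed
    have b_ext: "b \<in> prefs X A j" "extremal A \<Omega> j b y" if "b \<in> {L j, U j}" for b
      using that LU ext by auto
    \<comment> \<open>For single-dipped \<open>j\<close>, returning to \<open>R j\<close> would keep
      the outcome \<open>y\<close>. For single-peaked \<open>j\<close>, the side of the peak decides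
      whether \<open>b\<close> would be a profitable misreport at \<open>U i\<close> or at
      \<open>L i\<close>; \<open>swap\<close> covers the other report.\<close>
    have ne: "F a b \<noteq> y" if a: "a \<in> {L i, U i}" and b: "b \<in> {L j, U j}" for a b
    proof (cases "j \<in> A")
      case False
      have a': "a \<in> prefs X A i" using a LU by auto
      show ?thesis
      proof
        assume "F a b = y"
        have "f ((R(i := a, j := b))(j := R j)) = y"
          by (rule extremal_stays[OF prof(2)[OF a' b_ext(1)[OF b]] j(1) Rj])
            (use False b_ext[OF b] \<open>F a b = y\<close> in \<open>auto simp: F_def\<close>)
        then have "F a (R j) = y" by (simp add: F_def)
        then show False using F1 a L U by auto
      qed
    next
      case True
      have "F (U i) b \<noteq> y \<or> F (L i) b \<noteq> y"
      proof (cases "best \<Omega> (R j) \<le> y")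
        case le: True
        have "F (U i) b \<noteq> y"
        proof
          assume "F (U i) b = y"
          then have "(f (R(i := U i)), y) \<in> R j"
            using truthful[OF prof(1)[OF LU(2) Rj] j(1) b_ext(1)[OF b]] j(2) by (simp add: F_def)
          then show False
            using peak_towards(1)[OF R True y outcome[OF prof(1)[OF LU(2) Rj]]] U le by simp
        qed
        then show ?thesis ..
      next
        case ge: False
        have "F (L i) b \<noteq> y"
        proof
          assume "F (L i) b = y"
          then have "(f (R(i := L i)), y) \<in> R j"
            using truthful[OF prof(1)[OF LU(1) Rj] j(1) b_ext(1)[OF b]] j(2) by (simp add: F_def)
          then show False
            using peak_towards(2)[OF R True y outcome[OF prof(1)[OF LU(1) Rj]]] L ge by simp
        qed
        then show ?thesis ..
      qed
      then show ?thesis using swap a b_ext(1)[OF b] by blast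
    qed
    have UU: "F (U i) (U j) > y"
    proof -
      have "(F (U i) (U j), f (R(i := U i))) \<in> U j"
        using truthful'[OF prof(1)[OF LU(2) Rj] j(1) LU(2)] by (simp add: F_def)
      then have "F (U i) (U j) \<ge> y" using one_sided_up(1) U unfolding U_def by fastforce
      then show ?thesis using ne[of "U i" "U j"] by simp
    qed
    have LL: "F (L i) (L j) < y"
    proof -
      have "(F (L i) (L j), f (R(i := L i))) \<in> L j"
        using truthful'[OF prof(1)[OF LU(1) Rj] j(1) LU(1)] by (simp add: F_def)
      then have "F (L i) (L j) \<le> y" using one_sided_up(1) L unfolding L_def by fastforce
      then show ?thesis using ne[of "L i" "L j"] by simp
    qed
    have smaller: "card (K i (R(j := b))) < card (K i R)" "card (K j (R(i := a))) < card (K i R)"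
      if "b \<in> {L j, U j}" "a \<in> {L i, U i}" for a b
    proof -
      have e: "extremal A \<Omega> j b y" "extremal A \<Omega> i a y" using that ext by auto
      have "j \<notin> K i (R(j := b))" "j \<notin> K j (R(i := a))" using e by (simp_all add: K_def)
      moreover have "k \<in> K i R" if "k \<in> K i (R(j := b))" for k
        using that j(3) by (cases "k = j") (simp_all add: K_def)
      moreover have "k \<in> K i R" if "k \<in> K j (R(i := a))" for k
        using that e(2) by (cases "k = i") (simp_all add: K_def)
      moreover have "j \<in> K i R" using j by (simp add: K_def)
      ultimately have "K i (R(j := b)) \<subset> K i R" "K j (R(i := a)) \<subset> K i R" by blast+
      then show "card (K i (R(j := b))) < card (K i R)" "card (K j (R(i := a))) < card (K i R)"
        using finK psubset_card_mono by blast+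
    qed
    have tw: "R(j := b, i := a) = R(i := a, j := b)" for a b using j(2) by (simp add: fun_eq_iff)
    note IH = less.hyps[folded K_def, OF _ profile_upd, folded L_def U_def]
    \<comment> \<open>In the first two cases \<open>i\<close> remains pivotal, with \<open>j\<close>
      fixed at \<open>L j\<close> or \<open>U j\<close>; in the last \<open>j\<close> becomes
      pivotal, with \<open>i\<close> fixed at \<open>L i\<close>.\<close>
    consider "F (U i) (L j) > y" | "F (L i) (U j) < y" | "F (U i) (L j) < y" "F (L i) (U j) > y"
      using ne[of "U i" "L j"] ne[of "L i" "U j"] by fastforce
    then show False
    proof cases
      case 1
      then show False
        using IH[OF smaller(1) R j(1) LU(1) i, of "L i"] LL by (simp add: tw F_def)
    next
      case 2
      then show False
        using IH[OF smaller(1) R j(1) LU(2) i, of "L i"] UU by (simp add: tw F_def)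
    next
      case 3
      then show False
        using IH[OF smaller(2) R i LU(1) j(1), of "L j"] LL by (simp add: F_def)
    qed
  qed
qed

text \<open>If \<open>?U\<close> missed \<open>y\<close>, so would \<open>?L\<close>, and
  truthfulness would put their outcomes on opposite sides of \<open>y\<close>, against
  \<open>no_jump\<close>. A single-dipped agent could then return from \<open>?U\<close> to
  \<open>R i\<close> with outcome still \<open>y\<close>.\<close>

lemma option_between:
  assumes R: "R \<in> profiles X A D" and i: "i \<in> A \<union> D" and Q: "Q \<in> prefs X A i"
    and y: "y \<in> \<Omega>" "f R < y" "y < f (R(i := Q))"
  shows "i \<in> A" and "f (R(i := one_sided X A i 1 y)) = y"
proof -
  let ?L = "one_sided X A i (-1) y" and ?U = "one_sided X A i 1 y"
  have LU: "?L \<in> prefs X A i" "?U \<in> prefs X A i" using one_sided_pref[OF y(1)] by auto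
  have ext: "extremal A \<Omega> i ?L y" "extremal A \<Omega> i ?U y"
    using extremal_one_sided[OF y(1) range_subset] by auto
  note P = profile_upd[OF R i]
  have "f (R(i := ?U)) = y"
  proof (rule ccontr)
    assume U: "f (R(i := ?U)) \<noteq> y"
    have L: "f (R(i := ?L)) \<noteq> y"
    proof
      assume "f (R(i := ?L)) = y"
      then have "f (R(i := ?L, i := ?U)) = y"
        using ext by (intro extremal_stays[OF P[OF LU(1)] i LU(2)]) auto
      then show False using U by simp
    qed
    have "(f (R(i := ?L)), f R) \<in> ?L" by (rule truthful'[OF R i LU(1)])
    then have "f (R(i := ?L)) \<le> y" using one_sided_up(1) y(2) by fastforce
    moreover have "(f (R(i := ?U)), f (R(i := Q))) \<in> ?U"
      using truthful'[OF P[OF Q] i LU(2)] by simp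
    then have "f (R(i := ?U)) \<ge> y" using one_sided_up(1) y(3) by fastforce
    ultimately show False
      using no_jump[OF y(1) outcome[OF R] y(2) outcome[OF P[OF Q]] y(3) R i] L U by force
  qed
  then show U: "f (R(i := ?U)) = y" .
  show "i \<in> A"
  proof (rule ccontr)
    assume "i \<notin> A"
    then have "f (R(i := ?U, i := R i)) = y"
      using ext U by (intro extremal_stays[OF P[OF LU(2)] i profile_pref[OF R i]]) auto
    then show False using y(2) by simp
  qed
qed

text \<open>By \<open>option_between\<close> the agent could obtain such a peak exactly, which
  truthfulness excludes at both profiles.\<close>

lemma peak_not_between:
  assumes R: "R \<in> profiles X A D" and i: "i \<in> A" and Q: "Q \<in> prefs X A i"
  shows "\<not> (f R < best \<Omega> (R i) \<and> best \<Omega> (R i) < f (R(i := Q)))"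
    and "\<not> (f R < best \<Omega> Q \<and> best \<Omega> Q < f (R(i := Q)))"
proof -
  have iN: "i \<in> A \<union> D" using i by simp
  have RQ: "R(i := Q) \<in> profiles X A D" by (rule profile_upd[OF R iN Q])
  show "\<not> (f R < best \<Omega> (R i) \<and> best \<Omega> (R i) < f (R(i := Q)))"
  proof
    let ?y = "best \<Omega> (R i)"
    assume b: "f R < ?y \<and> ?y < f (R(i := Q))"
    note y = peak_mem[OF R i]
    have "(f R, ?y) \<in> R i"
      using truthful[OF R iN one_sided_pref[OF y], of 1] option_between(2)[OF R iN Q y] b by simp
    from linear_order_onD(2)[OF profile_linear[OF R iN] this peak_best[OF R i outcome[OF R]]]
    show False using b by simp
  qed
  show "\<not> (f R < best \<Omega> Q \<and> best \<Omega> Q < f (R(i := Q)))"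
  proof
    let ?y = "best \<Omega> Q" and ?R = "R(i := Q)"
    assume b: "f R < ?y \<and> ?y < f ?R"
    have y: "?y \<in> \<Omega>" using peak_mem[OF RQ i] by simp
    have "f (R(i := one_sided X A i 1 ?y)) = ?y" using option_between(2)[OF R iN Q y] b by blast
    then have "(f ?R, ?y) \<in> Q"
      using truthful[OF RQ iN one_sided_pref[OF y], of 1] by simp
    moreover have "(?y, f ?R) \<in> Q" using peak_best[OF RQ i outcome[OF RQ]] by simp
    ultimately have "f ?R = ?y" by (rule linear_order_onD(2)[OF prefs_linear[OF Q]])
    then show False using b by simp
  qed
qed

section \<open>Monotonicity of cuts of the range\<close>

definition cut_supporters :: "real \<Rightarrow> (nat \<Rightarrow> real rel) \<Rightarrow> nat set" where
  "cut_supporters c R = {i \<in> A. best \<Omega> (R i) \<le> c} \<union>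
     {i \<in> D. \<exists>c'. (c, c') \<in> gap_pairs \<Omega> \<and> strictly_prefers (R i) c c'}"

text \<open>Suppose agent \<open>i\<close> lifts the outcome across \<open>c\<close>. If
  \<open>i\<close> is single-peaked, truthfulness and \<open>peak_not_between\<close> force the old
  peak to be at most \<open>c\<close> and the new one above \<open>c\<close>. If \<open>i\<close> is
  single-dipped, the two outcomes are adjacent, the lower one is \<open>c\<close>, and the ranking
  of the two is reversed. Either way a supporter is lost.\<close>

lemma cut_monotone_step:
  assumes R: "R \<in> profiles X A D" and i: "i \<in> A \<union> D" and Q: "Q \<in> prefs X A i" and c: "c \<in> \<Omega>"
    and "f R \<le> c" and sup: "i \<in> cut_supporters c R \<Longrightarrow> i \<in> cut_supporters c (R(i := Q))"
  shows "f (R(i := Q)) \<le> c"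
proof (rule ccontr)
  let ?R = "R(i := Q)"
  have RQ: "?R \<in> profiles X A D" by (rule profile_upd[OF R i Q])
  assume "\<not> f ?R \<le> c"
  with assms(5) have uv: "f R \<le> c" "c < f ?R" by auto
  have t: "(f R, f ?R) \<in> R i" "(f ?R, f R) \<in> Q"
    using truthful[OF R i Q] truthful'[OF R i Q] by auto
  show False
  proof (cases "i \<in> A")
    case True
    note pk = peak_not_between[OF R True Q]
    have "f R < best \<Omega> Q"
      using peak_towards(1)[OF RQ True outcome[OF R] outcome[OF RQ]] t uv by simp
    then have "\<not> best \<Omega> Q \<le> c" using pk(2) uv by linarith
    then have "i \<notin> cut_supporters c ?R" using True disjoint by (auto simp: cut_supporters_def)
    then have "c < best \<Omega> (R i)" using sup True by (force simp: cut_supporters_def)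
    moreover have "best \<Omega> (R i) < f ?R"
      using peak_towards(2)[OF R True outcome[OF RQ] outcome[OF R]] t uv by simp
    ultimately show False using pk(1) uv by linarith
  next
    case False
    have gap: "(f R, f ?R) \<in> gap_pairs \<Omega>"
      using option_between(1)[OF R i Q] False outcome[OF R] outcome[OF RQ] uv
      by (auto simp: gap_pairs_def)
    then have "f R = c" using gap_pairs_cases[OF gap c] uv by simp
    moreover have "f R \<noteq> f ?R" using uv by simp
    ultimately have "strictly_prefers (R i) c (f ?R)" "\<not> strictly_prefers Q c (f ?R)"
      using t linear_order_onD(2)[OF profile_linear[OF R i]]
      by (auto simp: strictly_prefers_def)
    then have "i \<in> cut_supporters c R" and no: "\<not> strictly_prefers Q c (f ?R)"
      using gap \<open>f R = c\<close> False i by (auto simp: cut_supporters_def)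
    then obtain c' where "(c, c') \<in> gap_pairs \<Omega>" "strictly_prefers Q c c'"
      using sup False by (auto simp: cut_supporters_def)
    moreover have "c' = f ?R" if "(c, c') \<in> gap_pairs \<Omega>" for c'
      using gap_pairs_eq_or_apart[OF gap that] \<open>f R = c\<close> that uv by (auto simp: gap_pairs_def)
    ultimately show False using no by blast
  qed
qed

lemma cut_monotone:
  assumes R: "R \<in> profiles X A D" and R': "R' \<in> profiles X A D" and c: "c \<in> \<Omega>"
    and "f R \<le> c" and sub: "cut_supporters c R \<subseteq> cut_supporters c R'"
  shows "f R' \<le> c"
proof (rule profile_walk[OF R R', where P = "\<lambda>T. f T \<le> c"])
  fix T i
  assume T: "T \<in> profiles X A D" "f T \<le> c" "i \<in> A \<union> D" "T i = R i"
  show "f (T(i := R' i)) \<le> c"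
    by (rule cut_monotone_step[OF T(1,3) profile_pref[OF R' T(3)] c T(2)])
      (use sub T(4) in \<open>auto simp: cut_supporters_def\<close>)
qed (rule assms(4))

text \<open>For \<open>y\<close> strictly between the outcomes, give everyone in \<open>D\<close>
  the dip \<open>y\<close> with the lower side first. The outcome stays below \<open>y\<close>, yet
  nobody in \<open>D\<close> supports the cut at \<open>y\<close>; the remaining support depends
  only on the peaks, so \<open>cut_monotone\<close> carries the bound over to
  \<open>R'\<close>.\<close>

lemma same_peaks_gap:
  assumes R: "R \<in> profiles X A D" and R': "R' \<in> profiles X A D"
    and same: "\<And>i. i \<in> A \<Longrightarrow> best \<Omega> (R i) = best \<Omega> (R' i)"
    and lt: "f R < f R'"
  shows "(f R, f R') \<in> gap_pairs \<Omega>"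
proof -
  have False if y: "y \<in> \<Omega>" "f R < y" "y < f R'" for y
  proof -
    let ?R = "restrict (\<lambda>i. if i \<in> A then R i else one_sided X A i (-1) y) (A \<union> D)"
    have R'': "?R \<in> profiles X A D"
      by (rule profile_restrict) (use one_sided_pref[OF y(1), of "-1"] profile_pref[OF R] in auto)
    have "f ?R \<in> {u. u < y}"
      by (rule outcome_stays_in[OF R R''])
        (use y(2) one_sided_up(2)[of _ _ X A _ "-1" y] in \<open>auto split: if_splits\<close>)
    then have "f ?R \<le> y" by simp
    moreover have "cut_supporters y ?R \<subseteq> cut_supporters y R'"
    proof
      fix i assume i: "i \<in> cut_supporters y ?R"
      have "i \<in> A"
      proof (rule ccontr)
        assume "i \<notin> A"
        then obtain w where "w \<in> \<Omega>" "strictly_prefers (one_sided X A i (-1) y) y w"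
          using i by (auto simp: cut_supporters_def gap_pairs_def)
        then show False
          using extremal_one_sided[OF y(1) range_subset, of "-1" A i] \<open>i \<notin> A\<close>
          by (auto simp: extremal_def strictly_prefers_def)
      qed
      then show "i \<in> cut_supporters y R'"
        using i same[of i] disjoint by (auto simp: cut_supporters_def)
    qed
    ultimately have "f R' \<le> y" using cut_monotone[OF R'' R' y(1)] by blast
    then show False using y(3) by simp
  qed
  then have "{f R<..<f R'} \<inter> \<Omega> = {}" by auto
  then show ?thesis using outcome[OF R] outcome[OF R'] lt by (simp add: gap_pairs_def)
qed

end

section \<open>The median voter function of a strategy-proof rule\<close>

lemma le_star_refl: "\<alpha> \<le>\<^sup>* \<alpha>"
  by (cases \<alpha>) auto

lemma le_star_antisym:
  assumes "\<alpha> \<in> \<Omega> <+> gap_pairs \<Omega>" "\<beta> \<in> \<Omega> <+> gap_pairs \<Omega>" "\<alpha> \<le>\<^sup>* \<beta>" "\<beta> \<le>\<^sup>* \<alpha>"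
  shows "\<alpha> = \<beta>"
proof -
  have lt: "x < y" if "(x, y) \<in> gap_pairs \<Omega>" for x y using that by (auto simp: gap_pairs_def)
  have eq: "y = y'" if "(x, y) \<in> gap_pairs \<Omega>" "(x, y') \<in> gap_pairs \<Omega>" for x y y'
    using gap_pairs_eq_or_apart[OF that] lt[OF that(1)] lt[OF that(2)] by auto
  show ?thesis
  proof (cases \<alpha>)
    case (Inl z)
    show ?thesis
    proof (cases \<beta>)
      case (Inr c)
      then show ?thesis using assms lt Inl by (cases c) force
    qed (use assms Inl in auto)
  next
    case (Inr c)
    obtain x y where c: "c = (x, y)" by (cases c)
    show ?thesis
    proof (cases \<beta>)
      case (Inl z)
      then show ?thesis using assms lt[of x y] Inr c by auto
    next
      case (Inr c')
      obtain x' y' where "c' = (x', y')" by (cases c')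
      then show ?thesis using assms eq[of x y y'] Inr \<open>\<alpha> = Inr c\<close> c by auto
    qed
  qed
qed

lemma less_star_iff:
  assumes "\<alpha> \<in> \<Omega> <+> gap_pairs \<Omega>" "\<beta> \<in> \<Omega> <+> gap_pairs \<Omega>"
  shows "\<alpha> <\<^sup>* \<beta> \<longleftrightarrow> \<not> \<beta> \<le>\<^sup>* \<alpha>"
  using le_star_total[OF assms] by (auto simp: less_star_def)

lemma minimal_in_below:
  assumes "finite V" "B \<in> V"
  obtains C where "minimal_in V C" "C \<subseteq> B"
  using finite_has_minimal2[OF assms] by (auto simp: minimal_in_def)

context voting_rule
begin

lemma peaks_mem: "R \<in> profiles X A D \<Longrightarrow> peaks A \<Omega> R \<in> A \<rightarrow>\<^sub>E \<Omega>"
  using peak_mem by (auto simp: peaks_def)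

lemma profile_with_peaks:
  assumes p: "p \<in> A \<rightarrow>\<^sub>E \<Omega>" and c: "c \<in> \<Omega>" and s: "s = 1 \<or> s = -1"
  obtains R where "R \<in> profiles X A D" "peaks A \<Omega> R = p"
    and "\<And>i. i \<in> D \<Longrightarrow> R i = one_sided X A i s c"
proof
  let ?R = "restrict (\<lambda>i. if i \<in> A then one_sided X A i s (p i) else one_sided X A i s c) (A \<union> D)"
  have pm: "p i \<in> \<Omega>" if "i \<in> A" for i using p that by auto
  show "?R \<in> profiles X A D"
    by (rule profile_restrict) (simp add: one_sided_pref[OF _ s] pm c)
  show "peaks A \<Omega> ?R = p"
  proof
    fix i
    show "peaks A \<Omega> ?R i = p i"
      using best_one_sided[OF pm _ s] PiE_arb[OF p] by (cases "i \<in> A") (simp_all add: peaks_def)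
  qed
  show "?R i = one_sided X A i s c" if "i \<in> D" for i using that disjoint by auto
qed

lemma one_sided_worst:
  assumes "i \<in> D" "c \<in> \<Omega>" "u \<in> \<Omega>" "u \<noteq> c" and s: "s = 1 \<or> s = -1"
  shows "strictly_prefers (one_sided X A i s c) u c"
proof -
  have "i \<notin> A" using assms(1) disjoint by auto
  then have "(u, c) \<in> one_sided X A i s c"
    using extremal_one_sided[OF assms(2) range_subset s, of A i] assms(3)
    by (simp add: extremal_def)
  then show ?thesis
    using linear_order_onD(2)[OF prefs_linear[OF one_sided_pref[OF assms(2) s]]] assms(4)
    unfolding strictly_prefers_def by blast
qed

end

section \<open>Outcomes at fixed peaks and their median\<close>

context strategy_proof_rule
begin

definition outcomes :: "(nat \<Rightarrow> real) \<Rightarrow> real set" where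
  "outcomes p = f ` {R \<in> profiles X A D. peaks A \<Omega> R = p}"

text \<open>The first component of a pair in \<open>gap_pairs \<Omega>\<close> is the smaller one,
  so the choice by \<open>SOME\<close> is determined by the set of outcomes.\<close>

definition median :: "(nat \<Rightarrow> real) \<Rightarrow> real + real \<times> real" where
  "median p = (if \<exists>x. outcomes p = {x} then Inl (THE x. outcomes p = {x})
     else Inr (SOME \<alpha>. \<alpha> \<in> gap_pairs \<Omega> \<and> outcomes p = {fst \<alpha>, snd \<alpha>}))"

lemma outcomesI: "R \<in> profiles X A D \<Longrightarrow> f R \<in> outcomes (peaks A \<Omega> R)"
  by (auto simp: outcomes_def)

text \<open>By \<open>same_peaks_gap\<close> distinct outcomes at fixed peaks are adjacent. Three
  are impossible, since one would lie strictly between the others.\<close>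

lemma median_cases:
  assumes p: "p \<in> A \<rightarrow>\<^sub>E \<Omega>"
  obtains (single) x where "x \<in> \<Omega>" "median p = Inl x" "outcomes p = {x}"
    | (gap) x y where "(x, y) \<in> gap_pairs \<Omega>" "median p = Inr (x, y)" "outcomes p = {x, y}"
proof -
  obtain w where w: "w \<in> \<Omega>" using range_nonempty by blast
  obtain R where "R \<in> profiles X A D" "peaks A \<Omega> R = p"
    using profile_with_peaks[OF p w, of 1] by auto
  then obtain u where u: "u \<in> outcomes p" using outcomesI by blast
  have out: "outcomes p \<subseteq> \<Omega>" using outcome by (auto simp: outcomes_def)
  have gap: "(v, v') \<in> gap_pairs \<Omega>" if v: "v \<in> outcomes p" "v' \<in> outcomes p" "v < v'" for v v'
  proof -
    obtain R R' where R: "R \<in> profiles X A D" "peaks A \<Omega> R = p" "f R = v"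
      and R': "R' \<in> profiles X A D" "peaks A \<Omega> R' = p" "f R' = v'"
      using v by (auto simp: outcomes_def)
    have "best \<Omega> (R i) = best \<Omega> (R' i)" if "i \<in> A" for i
    proof -
      have "peaks A \<Omega> R i = peaks A \<Omega> R' i" using R(2) R'(2) by simp
      then show ?thesis using that by (simp add: peaks_def)
    qed
    then show ?thesis using same_peaks_gap[OF R(1) R'(1)] R(3) R'(3) v(3) by simp
  qed
  show ?thesis
  proof (cases "\<exists>x. outcomes p = {x}")
    case True
    then obtain x where "outcomes p = {x}" by blast
    then show ?thesis using single[of x] out by (simp add: median_def)
  next
    case False
    then obtain v where v: "v \<in> outcomes p" "v \<noteq> u" using u by blast
    define a b where "a = min u v" and "b = max u v"
    have ab: "a \<in> outcomes p" "b \<in> outcomes p" "a < b"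
      using u v by (auto simp: a_def b_def min_def max_def)
    have "w = a \<or> w = b" if w: "w \<in> outcomes p" for w
    proof (rule ccontr)
      assume "\<not> ?thesis"
      then consider "w < a" | "a < w" "w < b" | "b < w" by linarith
      then show False
      proof cases
        case 1
        then show False using gap[OF w ab(2)] ab out by (auto simp: gap_pairs_def)
      next
        case 2
        then show False using gap[OF ab] w out by (auto simp: gap_pairs_def)
      next
        case 3
        then show False using gap[OF ab(1) w] ab out by (auto simp: gap_pairs_def)
      qed
    qed
    then have "(a, b) \<in> gap_pairs \<Omega> \<and> outcomes p = {a, b}" using gap[OF ab] ab by auto
    then have ex: "\<exists>\<alpha>. \<alpha> \<in> gap_pairs \<Omega> \<and> outcomes p = {fst \<alpha>, snd \<alpha>}" by force
    define \<alpha> where "\<alpha> = (SOME \<alpha>. \<alpha> \<in> gap_pairs \<Omega> \<and> outcomes p = {fst \<alpha>, snd \<alpha>})"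
    have \<alpha>: "\<alpha> \<in> gap_pairs \<Omega> \<and> outcomes p = {fst \<alpha>, snd \<alpha>}"
      unfolding \<alpha>_def by (rule someI_ex[OF ex])
    have "median p = Inr \<alpha>" using False by (simp add: median_def \<alpha>_def)
    then show ?thesis using \<alpha> that(2)[of "fst \<alpha>" "snd \<alpha>"] by simp
  qed
qed

lemma median_mem:
  assumes "p \<in> A \<rightarrow>\<^sub>E \<Omega>"
  shows "median p \<in> \<Omega> <+> gap_pairs \<Omega>"
  using assms by (cases rule: median_cases) auto

text \<open>Universal here, existential for pairs: both components of a median pair occur as
  outcomes, and comparison with a point concerns the larger one, comparison with a pair the smaller
  one.\<close>

lemma median_le_Inl:
  assumes "p \<in> A \<rightarrow>\<^sub>E \<Omega>"
  shows "median p \<le>\<^sup>* Inl c \<longleftrightarrow> (\<forall>u\<in>outcomes p. u \<le> c)"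
  using assms by (cases rule: median_cases) (auto simp: gap_pairs_def)

lemma median_le_Inr:
  assumes "p \<in> A \<rightarrow>\<^sub>E \<Omega>"
  shows "median p \<le>\<^sup>* Inr (c, c') \<longleftrightarrow> (\<exists>u\<in>outcomes p. u \<le> c)"
  using assms by (cases rule: median_cases) (auto simp: gap_pairs_def)

lemma cut_supporters_peaks: "A \<inter> cut_supporters c R = {i \<in> A. peaks A \<Omega> R i \<le> c}"
  using disjoint by (auto simp: cut_supporters_def peaks_def)

text \<open>The least support of the cut at \<open>c\<close> compatible with \<open>p\<close>:
  everyone in \<open>D\<close> has the dip \<open>c\<close>.\<close>

lemma profile_opposed:
  assumes "p \<in> A \<rightarrow>\<^sub>E \<Omega>" "c \<in> \<Omega>"
  obtains R where "R \<in> profiles X A D" "peaks A \<Omega> R = p" "cut_supporters c R = {i \<in> A. p i \<le> c}"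
proof -
  obtain R where R: "R \<in> profiles X A D" "peaks A \<Omega> R = p"
    "\<And>i. i \<in> D \<Longrightarrow> R i = one_sided X A i 1 c"
    using profile_with_peaks[OF assms, of 1] by auto
  have "i \<in> A" if i: "i \<in> cut_supporters c R" for i
  proof (rule ccontr)
    assume "i \<notin> A"
    then obtain c' where "i \<in> D" "c' \<in> \<Omega>" "c < c'" "strictly_prefers (R i) c c'"
      using i by (auto simp: cut_supporters_def gap_pairs_def)
    then show False
      using one_sided_worst[of i c c' 1] assms(2) R(3)[of i] by (auto simp: strictly_prefers_def)
  qed
  then have "cut_supporters c R = A \<inter> cut_supporters c R" by auto
  then show ?thesis using that[OF R(1,2)] cut_supporters_peaks[of c R] R(2) by simp
qed

text \<open>The greatest support compatible with \<open>p\<close>: everyone in \<open>D\<close> has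
  the dip \<open>c'\<close>.\<close>

lemma profile_supporting:
  assumes "p \<in> A \<rightarrow>\<^sub>E \<Omega>" "(c, c') \<in> gap_pairs \<Omega>"
  obtains R where "R \<in> profiles X A D" "peaks A \<Omega> R = p" "cut_supporters c R = {i \<in> A. p i \<le> c} \<union> D"
proof -
  have c: "c \<in> \<Omega>" "c' \<in> \<Omega>" "c \<noteq> c'" using assms(2) by (auto simp: gap_pairs_def)
  obtain R where R: "R \<in> profiles X A D" "peaks A \<Omega> R = p"
    "\<And>i. i \<in> D \<Longrightarrow> R i = one_sided X A i 1 c'"
    using profile_with_peaks[OF assms(1) c(2), of 1] by auto
  have "D \<subseteq> cut_supporters c R"
  proof
    fix i assume i: "i \<in> D"
    then have "strictly_prefers (R i) c c'"
      using one_sided_worst[OF i c(2,1,3), of 1] R(3)[OF i] by simp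
    then show "i \<in> cut_supporters c R" using i assms(2) by (auto simp: cut_supporters_def)
  qed
  moreover have "cut_supporters c R \<subseteq> A \<union> D" by (auto simp: cut_supporters_def)
  ultimately have "cut_supporters c R = (A \<inter> cut_supporters c R) \<union> D" by auto
  then show ?thesis using that[OF R(1,2)] cut_supporters_peaks[of c R] R(2) by simp
qed

text \<open>For a point, the least support at \<open>p\<close> lies in every support at
  \<open>q\<close>; for a pair, the greatest support at \<open>q\<close> contains every support at
  \<open>p\<close>. This matches the quantifiers of \<open>median_le_Inl\<close> and
  \<open>median_le_Inr\<close>, and \<open>cut_monotone\<close> applies.\<close>

lemma median_monotone:
  assumes p: "p \<in> A \<rightarrow>\<^sub>E \<Omega>" and q: "q \<in> A \<rightarrow>\<^sub>E \<Omega>" and \<alpha>: "\<alpha> \<in> \<Omega> <+> gap_pairs \<Omega>"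
    and sub: "{i \<in> A. Inl (p i) \<le>\<^sup>* \<alpha>} \<subseteq> {i \<in> A. Inl (q i) \<le>\<^sup>* \<alpha>}" and le: "median p \<le>\<^sup>* \<alpha>"
  shows "median q \<le>\<^sup>* \<alpha>"
proof (cases \<alpha>)
  case (Inl c)
  then have c: "c \<in> \<Omega>" using \<alpha> by auto
  obtain R where R: "R \<in> profiles X A D" "peaks A \<Omega> R = p" "cut_supporters c R = {i \<in> A. p i \<le> c}"
    by (rule profile_opposed[OF p c])
  have "f R \<le> c" using median_le_Inl[OF p, of c] le Inl outcomesI[OF R(1)] R(2) by simp
  have "f T \<le> c" if T: "T \<in> profiles X A D" "peaks A \<Omega> T = q" for T
  proof (rule cut_monotone[OF R(1) T(1) c \<open>f R \<le> c\<close>])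
    show "cut_supporters c R \<subseteq> cut_supporters c T"
      using sub R(3) cut_supporters_peaks[of c T] T(2) Inl by auto
  qed
  then show ?thesis using median_le_Inl[OF q, of c] Inl by (auto simp: outcomes_def)
next
  case (Inr cc)
  then obtain c c' where cc: "cc = (c, c')" "(c, c') \<in> gap_pairs \<Omega>" using \<alpha> by (cases cc) auto
  then have c: "c \<in> \<Omega>" by (auto simp: gap_pairs_def)
  obtain T where T: "T \<in> profiles X A D" "peaks A \<Omega> T = q"
    "cut_supporters c T = {i \<in> A. q i \<le> c} \<union> D"
    by (rule profile_supporting[OF q cc(2)])
  obtain R where R: "R \<in> profiles X A D" "peaks A \<Omega> R = p" "f R \<le> c"
    using median_le_Inr[OF p, of c c'] le Inr cc(1) by (auto simp: outcomes_def)
  have "f T \<le> c"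
  proof (rule cut_monotone[OF R(1) T(1) c R(3)])
    have "cut_supporters c R \<subseteq> (A \<inter> cut_supporters c R) \<union> D" by (auto simp: cut_supporters_def)
    then show "cut_supporters c R \<subseteq> cut_supporters c T"
      using sub T(3) cut_supporters_peaks[of c R] R(2) Inr cc(1) by auto
  qed
  then show ?thesis using median_le_Inr[OF q, of c c'] Inr cc(1) outcomesI[OF T(1)] T(2) by auto
qed

section \<open>The left coalition system\<close>

text \<open>
  At \<open>Inl (max \<Omega>)\<close> the general clause would yield only \<open>{A}\<close>, because no peak lies above it; the
  monotonicity of a left coalition system forces the larger collection.
\<close>

definition coalitions :: "real + real \<times> real \<Rightarrow> nat set set" where
  "coalitions \<alpha> = (if \<exists>m. is_max \<Omega> m \<and> \<alpha> = Inl m then Pow A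
     else {B. B \<subseteq> A \<and> (\<exists>p\<in>A \<rightarrow>\<^sub>E \<Omega>. {i \<in> A. Inl (p i) \<le>\<^sup>* \<alpha>} \<subseteq> B \<and> median p \<le>\<^sup>* \<alpha>)})"

lemma coalitions_iff:
  assumes "\<not> (\<exists>m. is_max \<Omega> m \<and> \<alpha> = Inl m)"
  shows "B \<in> coalitions \<alpha> \<longleftrightarrow>
    B \<subseteq> A \<and> (\<exists>p\<in>A \<rightarrow>\<^sub>E \<Omega>. {i \<in> A. Inl (p i) \<le>\<^sup>* \<alpha>} \<subseteq> B \<and> median p \<le>\<^sup>* \<alpha>)"
  unfolding coalitions_def if_not_P[OF assms] by simp

lemma coalitions_subset: "B \<in> coalitions \<alpha> \<Longrightarrow> B \<subseteq> A"
  by (cases "\<exists>m. is_max \<Omega> m \<and> \<alpha> = Inl m") (simp add: coalitions_def, simp add: coalitions_iff)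

lemma coalitions_up: "B \<in> coalitions \<alpha> \<Longrightarrow> B \<subseteq> C \<Longrightarrow> C \<subseteq> A \<Longrightarrow> C \<in> coalitions \<alpha>"
  by (cases "\<exists>m. is_max \<Omega> m \<and> \<alpha> = Inl m") (simp add: coalitions_def, simp add: coalitions_iff, blast)

text \<open>\<open>median_monotone\<close> trades the witness in \<open>coalitions\<close> for the
  given \<open>p\<close>. At the maximum both sides hold.\<close>

lemma median_le_iff:
  assumes p: "p \<in> A \<rightarrow>\<^sub>E \<Omega>" and \<alpha>: "\<alpha> \<in> \<Omega> <+> gap_pairs \<Omega>"
  shows "median p \<le>\<^sup>* \<alpha> \<longleftrightarrow> {i \<in> A. Inl (p i) \<le>\<^sup>* \<alpha>} \<in> coalitions \<alpha>"
proof (cases "\<exists>m. is_max \<Omega> m \<and> \<alpha> = Inl m")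
  case True
  then obtain m where m: "is_max \<Omega> m" "\<alpha> = Inl m" by blast
  have "u \<le> m" if "u \<in> outcomes p" for u
    using that m(1) outcome by (auto simp: is_max_def outcomes_def)
  then have "median p \<le>\<^sup>* \<alpha>" using median_le_Inl[OF p] m(2) by simp
  then show ?thesis using True by (simp add: coalitions_def)
next
  case False
  show ?thesis
    unfolding coalitions_iff[OF False] using p median_monotone[OF _ p \<alpha>] by blast
qed

lemma coalitions_mono:
  assumes \<alpha>: "\<alpha> \<in> \<Omega> <+> gap_pairs \<Omega>" and \<beta>: "\<beta> \<in> \<Omega> <+> gap_pairs \<Omega>"
    and "\<alpha> <\<^sup>* \<beta>" and B: "B \<in> coalitions \<alpha>"
  shows "B \<in> coalitions \<beta>"
proof (cases "\<exists>m. is_max \<Omega> m \<and> \<beta> = Inl m")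
  case True
  then show ?thesis using coalitions_subset[OF B] by (simp add: coalitions_def)
next
  case False
  have le: "\<alpha> \<le>\<^sup>* \<beta>" "\<not> \<beta> \<le>\<^sup>* \<alpha>" using assms(3) by (auto simp: less_star_def)
  obtain z where z: "z \<in> \<Omega>" "\<not> Inl z \<le>\<^sup>* \<beta>"
  proof (cases \<beta>)
    case (Inl y)
    then obtain z where "z \<in> \<Omega>" "\<not> z \<le> y" using False \<beta> by (auto simp: is_max_def)
    then show ?thesis using that Inl by auto
  next
    case (Inr c)
    then show ?thesis using that \<beta> by (cases c) (auto simp: gap_pairs_def)
  qed
  have "\<not> (\<exists>m. is_max \<Omega> m \<and> \<alpha> = Inl m)"
  proof
    assume "\<exists>m. is_max \<Omega> m \<and> \<alpha> = Inl m"
    then obtain m where m: "is_max \<Omega> m" "\<alpha> = Inl m" by blast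
    show False
      using \<beta> le(2) m by (cases \<beta>) (auto simp: is_max_def gap_pairs_def)
  qed
  then obtain p where p: "p \<in> A \<rightarrow>\<^sub>E \<Omega>" "{i \<in> A. Inl (p i) \<le>\<^sup>* \<alpha>} \<subseteq> B" "median p \<le>\<^sup>* \<alpha>"
    using B coalitions_iff by blast
  \<comment> \<open>Peaks beyond \<open>\<alpha>\<close> move to \<open>z\<close>, which is beyond
    \<open>\<beta>\<close>: no support at \<open>\<alpha>\<close> is lost, and nobody outside
    \<open>B\<close> supports \<open>\<beta>\<close>.\<close>
  let ?q = "restrict (\<lambda>i. if Inl (p i) \<le>\<^sup>* \<alpha> then p i else z) A"
  have q: "?q \<in> A \<rightarrow>\<^sub>E \<Omega>" using p(1) z(1) by auto
  have "median ?q \<le>\<^sup>* \<alpha>" by (rule median_monotone[OF p(1) q \<alpha> _ p(3)]) auto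
  then have "median ?q \<le>\<^sup>* \<beta>" using le_star_trans[OF median_mem[OF q] \<alpha> \<beta>] le(1) by blast
  then have "{i \<in> A. Inl (?q i) \<le>\<^sup>* \<beta>} \<in> coalitions \<beta>" using median_le_iff[OF q \<beta>] by simp
  moreover have "{i \<in> A. Inl (?q i) \<le>\<^sup>* \<beta>} \<subseteq> B" using p(2) z(2) by auto
  ultimately show ?thesis using coalitions_up coalitions_subset[OF B] by blast
qed

text \<open>Otherwise some profile with all peaks at \<open>z\<close> has an outcome at most
  \<open>t\<close> although nobody supports the cut at \<open>t\<close>. Then
  \<open>cut_monotone\<close> bounds every outcome by \<open>t\<close>, but \<open>z\<close> is an
  outcome.\<close>

lemma empty_not_coalition:
  assumes \<alpha>: "\<alpha> \<in> \<Omega> <+> gap_pairs \<Omega>" and t: "t \<in> \<Omega>" "\<alpha> \<le>\<^sup>* Inl t" and z: "z \<in> \<Omega>" "t < z"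
  shows "{} \<notin> coalitions \<alpha>"
proof
  assume e: "{} \<in> coalitions \<alpha>"
  let ?p = "\<lambda>i\<in>A. z"
  have p: "?p \<in> A \<rightarrow>\<^sub>E \<Omega>" using z(1) by auto
  have "{i \<in> A. Inl (?p i) \<le>\<^sup>* \<alpha>} \<in> coalitions \<alpha>" by (rule coalitions_up[OF e]) auto
  then have "median ?p \<le>\<^sup>* \<alpha>" using median_le_iff[OF p \<alpha>] by simp
  then have le: "median ?p \<le>\<^sup>* Inl t"
    using le_star_trans[OF median_mem[OF p] \<alpha> _ _ t(2)] t(1) by blast
  obtain R where R: "R \<in> profiles X A D" "peaks A \<Omega> R = ?p" "cut_supporters t R = {i \<in> A. ?p i \<le> t}"
    by (rule profile_opposed[OF p t(1)])
  have "f R \<le> t" using le median_le_Inl[OF p] outcomesI[OF R(1)] R(2) by simp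
  moreover have "cut_supporters t R = {}" using R(3) z(2) by auto
  moreover obtain T where "T \<in> profiles X A D" "f T = z" using z(1) range by auto
  ultimately show False using cut_monotone[OF R(1) _ t(1)] z(2) by fastforce
qed

section \<open>Range conditions and coalition axioms for the median\<close>

definition median_range :: "(real + real \<times> real) set" where
  "median_range = median ` (A \<rightarrow>\<^sub>E \<Omega>)"

lemma median_range_subset: "median_range \<subseteq> \<Omega> <+> gap_pairs \<Omega>"
  using median_mem by (auto simp: median_range_def)

lemma interior_median_range:
  assumes "x \<in> \<Omega>" "\<not> is_min \<Omega> x" "\<not> is_max \<Omega> x"
  shows "Inl x \<in> median_range"
proof -
  obtain u v where u: "u \<in> \<Omega>" "u < x" and v: "v \<in> \<Omega>" "x < v"
    using assms by (force simp: is_min_def is_max_def)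
  let ?p = "\<lambda>i\<in>A. x"
  have p: "?p \<in> A \<rightarrow>\<^sub>E \<Omega>" using assms(1) by auto
  have "f R = x" if R: "R \<in> profiles X A D" "peaks A \<Omega> R = ?p" for R
  proof (rule unanimous_interior[OF assms(1) u v R(1)])
    fix i assume i: "i \<in> A"
    then have "best \<Omega> (R i) = x" using fun_cong[OF R(2), of i] by (simp add: peaks_def)
    then show "extremal A \<Omega> i (R i) x" using peak_best[OF R(1) i] i by (auto simp: extremal_def)
  qed
  then have "outcomes ?p \<subseteq> {x}" by (auto simp: outcomes_def)
  from p have "median ?p = Inl x"
  proof (cases rule: median_cases)
    case (single y)
    then show ?thesis using \<open>outcomes ?p \<subseteq> {x}\<close> by auto
  next
    case (gap y z)
    then show ?thesis using \<open>outcomes ?p \<subseteq> {x}\<close> by (auto simp: gap_pairs_def)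
  qed
  then show ?thesis using imageI[OF p, of median] by (simp add: median_range_def)
qed

lemma outcome_median:
  assumes "x \<in> \<Omega>"
  obtains p where "p \<in> A \<rightarrow>\<^sub>E \<Omega>" "x \<in> outcomes p"
proof -
  obtain R where R: "R \<in> profiles X A D" "f R = x" using assms range by auto
  show ?thesis using that[OF peaks_mem[OF R(1)]] outcomesI[OF R(1)] R(2) by simp
qed

text \<open>An extreme outcome is attained, and the median at the peaks concerned is that point or a
  pair ending in it.\<close>

lemma median_range_conditions: "range_conditions \<Omega> median_range"
  unfolding range_conditions_def
proof (intro conjI allI impI)
  show "Inl ` {x \<in> \<Omega>. \<not> is_min \<Omega> x \<and> \<not> is_max \<Omega> x} \<subseteq> median_range"
    using interior_median_range by auto
  show "median_range \<subseteq> \<Omega> <+> gap_pairs \<Omega>" by (rule median_range_subset)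
next
  fix m assume m: "is_min \<Omega> m \<and> \<not> (\<exists>x\<in>\<Omega>. Inr (m, x) \<in> median_range)"
  then obtain p where p: "p \<in> A \<rightarrow>\<^sub>E \<Omega>" "m \<in> outcomes p"
    using outcome_median by (auto simp: is_min_def)
  then have r: "median p \<in> median_range" by (auto simp: median_range_def)
  from p(1) show "Inl m \<in> median_range"
  proof (cases rule: median_cases)
    case (single x)
    then show ?thesis using p(2) r by simp
  next
    case (gap x y)
    then have "x = m" using p(2) m by (auto simp: is_min_def gap_pairs_def)
    then show ?thesis using gap r m by (auto simp: gap_pairs_def)
  qed
next
  fix m assume m: "is_max \<Omega> m \<and> \<not> (\<exists>x\<in>\<Omega>. Inr (x, m) \<in> median_range)"
  then obtain p where p: "p \<in> A \<rightarrow>\<^sub>E \<Omega>" "m \<in> outcomes p"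
    using outcome_median by (auto simp: is_max_def)
  then have r: "median p \<in> median_range" by (auto simp: median_range_def)
  from p(1) show "Inl m \<in> median_range"
  proof (cases rule: median_cases)
    case (single x)
    then show ?thesis using p(2) r by simp
  next
    case (gap x y)
    then have "y = m" using p(2) m by (auto simp: is_max_def gap_pairs_def)
    then show ?thesis using gap r m by (auto simp: gap_pairs_def)
  qed
qed

lemma median_coalition_system: "left_coalition_system A \<Omega> median_range coalitions"
  unfolding left_coalition_system_def
proof (intro conjI)
  note mem = subsetD[OF median_range_subset]
  show "\<forall>\<alpha>\<in>median_range. coalitions \<alpha> \<subseteq> Pow A" using coalitions_subset by blast
  show "\<forall>\<alpha>\<in>median_range. \<forall>C C'. C \<in> coalitions \<alpha> \<and> C \<subset> C' \<and> C' \<subseteq> A \<longrightarrow> C' \<in> coalitions \<alpha>"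
    using coalitions_up by blast
  show "\<forall>\<alpha>\<in>median_range. \<forall>\<beta>\<in>median_range. \<forall>C. \<alpha> <\<^sup>* \<beta> \<and> C \<in> coalitions \<alpha> \<longrightarrow> C \<in> coalitions \<beta>"
    using coalitions_mono mem by blast
  have top: "\<exists>t\<in>\<Omega>. \<alpha> \<le>\<^sup>* Inl t \<and> (\<alpha> = Inl t \<or> (\<exists>x. \<alpha> = Inr (x, t)))" if "\<alpha> \<in> median_range" for \<alpha>
    using mem[OF that] by (cases \<alpha>) (auto simp: gap_pairs_def)
  show "\<forall>m. is_max \<Omega> m \<and> Inl m \<notin> median_range \<longrightarrow>
    (\<exists>\<mu>\<in>median_range. (\<forall>\<alpha>\<in>median_range. \<alpha> \<le>\<^sup>* \<mu>) \<and>
      (\<forall>\<alpha>\<in>median_range - {\<mu>}. {} \<in> coalitions \<mu> - coalitions \<alpha>))"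
  proof (intro allI impI)
    fix m assume m: "is_max \<Omega> m \<and> Inl m \<notin> median_range"
    then obtain x where r: "Inr (x, m) \<in> median_range"
      using median_range_conditions unfolding range_conditions_def by blast
    let ?\<mu> = "Inr (x, m) :: real + real \<times> real"
    have gap: "(x, m) \<in> gap_pairs \<Omega>" using mem[OF r] by auto
    have mm: "m \<in> \<Omega>" "\<And>y. y \<in> \<Omega> \<Longrightarrow> y \<le> m" using m by (auto simp: is_max_def)
    have top\<mu>: "\<alpha> \<le>\<^sup>* ?\<mu>" if \<alpha>: "\<alpha> \<in> median_range" for \<alpha>
    proof (cases \<alpha>)
      case (Inl y)
      then have "y \<in> \<Omega>" "y \<noteq> m" using mem[OF \<alpha>] \<alpha> m by auto
      then have "y \<le> x" using gap_pairs_cases[OF gap, of y] mm(2)[of y] by linarith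
      then show ?thesis using Inl by simp
    next
      case (Inr c)
      then obtain a b where c: "c = (a, b)" "a \<in> \<Omega>" "b \<in> \<Omega>" "a < b"
        using mem[OF \<alpha>] by (auto simp: gap_pairs_def)
      then have "a \<le> x" using gap_pairs_cases[OF gap, of a] mm(2)[of b] by linarith
      then show ?thesis using Inr c(1) by simp
    qed
    \<comment> \<open>With all peaks at \<open>m\<close> nobody supports \<open>?\<mu>\<close>, yet
      the median is at most \<open>?\<mu>\<close>, the last element of the range.\<close>
    have "{} \<in> coalitions ?\<mu>"
    proof -
      let ?p = "\<lambda>i\<in>A. m"
      have p: "?p \<in> A \<rightarrow>\<^sub>E \<Omega>" using mm(1) by auto
      then have "median ?p \<in> median_range" by (auto simp: median_range_def)
      then have "{i \<in> A. Inl (?p i) \<le>\<^sup>* ?\<mu>} \<in> coalitions ?\<mu>"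
        using median_le_iff[OF p mem[OF r]] top\<mu> by blast
      moreover have "{i \<in> A. Inl (?p i) \<le>\<^sup>* ?\<mu>} = {}" using gap by (auto simp: gap_pairs_def)
      ultimately show ?thesis by (simp only:)
    qed
    moreover have "{} \<notin> coalitions \<alpha>" if \<alpha>: "\<alpha> \<in> median_range" "\<alpha> \<noteq> ?\<mu>" for \<alpha>
    proof -
      obtain t where t: "t \<in> \<Omega>" "\<alpha> \<le>\<^sup>* Inl t" "\<alpha> = Inl t \<or> (\<exists>y. \<alpha> = Inr (y, t))"
        using top[OF \<alpha>(1)] by blast
      \<comment> \<open>Only \<open>?\<mu>\<close> has upper end \<open>m\<close>: the point
        \<open>m\<close> is outside the range, and two pairs ending in \<open>m\<close>
        coincide.\<close>
      have "t \<noteq> m"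
      proof
        assume "t = m"
        then obtain y where y: "\<alpha> = Inr (y, m)" using t(3) \<alpha>(1) m by auto
        then have ym: "(y, m) \<in> gap_pairs \<Omega>" using mem[OF \<alpha>(1)] by auto
        then have "y < m" "x < m" using gap by (auto simp: gap_pairs_def)
        then have "y = x" using gap_pairs_eq_or_apart[OF gap ym] by auto
        then show False using y \<alpha>(2) by simp
      qed
      then have "t < m" using mm(2)[OF t(1)] by simp
      then show ?thesis by (rule empty_not_coalition[OF mem[OF \<alpha>(1)] t(1,2) mm(1)])
    qed
    ultimately show "\<exists>\<mu>\<in>median_range. (\<forall>\<alpha>\<in>median_range. \<alpha> \<le>\<^sup>* \<mu>) \<and>
        (\<forall>\<alpha>\<in>median_range - {\<mu>}. {} \<in> coalitions \<mu> - coalitions \<alpha>)"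
      using r top\<mu> by blast
  qed
  show "(\<nexists>m. is_max \<Omega> m) \<longrightarrow> (\<forall>\<alpha>\<in>median_range. {} \<notin> coalitions \<alpha>)"
  proof (intro impI ballI)
    fix \<alpha> assume no: "\<nexists>m. is_max \<Omega> m" and \<alpha>: "\<alpha> \<in> median_range"
    obtain t where t: "t \<in> \<Omega>" "\<alpha> \<le>\<^sup>* Inl t" using top[OF \<alpha>] by blast
    then obtain z where "z \<in> \<Omega>" "t < z" using no by (auto simp: is_max_def not_le)
    then show "{} \<notin> coalitions \<alpha>" by (rule empty_not_coalition[OF mem[OF \<alpha>] t])
  qed
qed

text \<open>By \<open>median_le_iff\<close> the coalition conditions say that
  \<open>\<alpha>\<close> is the first element of the range at or above \<open>median p\<close>,
  which is \<open>median p\<close> itself.\<close>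

lemma median_generalized: "generalized_median_voter A \<Omega> median_range coalitions median"
  unfolding generalized_median_voter_def
proof (intro conjI ballI)
  note mem = subsetD[OF median_range_subset]
  show "median ` (A \<rightarrow>\<^sub>E \<Omega>) = median_range" by (simp add: median_range_def)
  show "range_conditions \<Omega> median_range" by (rule median_range_conditions)
  show "left_coalition_system A \<Omega> median_range coalitions" by (rule median_coalition_system)
  fix p \<alpha> assume p: "p \<in> A \<rightarrow>\<^sub>E \<Omega>" and \<alpha>: "\<alpha> \<in> median_range"
  have r: "median p \<in> median_range" using p by (auto simp: median_range_def)
  have "median p = \<alpha> \<longleftrightarrow> median p \<le>\<^sup>* \<alpha> \<and> (\<forall>\<beta>\<in>median_range. \<beta> <\<^sup>* \<alpha> \<longrightarrow> \<not> median p \<le>\<^sup>* \<beta>)"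
  proof
    assume "median p = \<alpha>"
    then show "median p \<le>\<^sup>* \<alpha> \<and> (\<forall>\<beta>\<in>median_range. \<beta> <\<^sup>* \<alpha> \<longrightarrow> \<not> median p \<le>\<^sup>* \<beta>)"
      by (auto simp: less_star_def le_star_refl)
  next
    assume a: "median p \<le>\<^sup>* \<alpha> \<and> (\<forall>\<beta>\<in>median_range. \<beta> <\<^sup>* \<alpha> \<longrightarrow> \<not> median p \<le>\<^sup>* \<beta>)"
    then have "\<alpha> \<le>\<^sup>* median p" using r le_star_refl by (auto simp: less_star_def)
    then show "median p = \<alpha>" using le_star_antisym[OF mem[OF r] mem[OF \<alpha>]] a by blast
  qed
  also have "\<dots> \<longleftrightarrow> {i \<in> A. Inl (p i) \<le>\<^sup>* \<alpha>} \<in> coalitions \<alpha> \<and>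
      (\<forall>\<beta>\<in>median_range. \<beta> <\<^sup>* \<alpha> \<longrightarrow> {i \<in> A. Inl (p i) \<le>\<^sup>* \<beta>} \<notin> coalitions \<beta>)"
    using median_le_iff[OF p mem] \<alpha> by blast
  finally show "median p = \<alpha> \<longleftrightarrow> {i \<in> A. Inl (p i) \<le>\<^sup>* \<alpha>} \<in> coalitions \<alpha> \<and>
      (\<forall>\<beta>\<in>median_range. \<beta> <\<^sup>* \<alpha> \<longrightarrow> {i \<in> A. Inl (p i) \<le>\<^sup>* \<beta>} \<notin> coalitions \<beta>)" .
qed

section \<open>Voting between adjacent outcomes\<close>

lemma left_supporters_eq:
  assumes gap: "(x, y) \<in> gap_pairs \<Omega>" and R: "R \<in> profiles X A D"
  shows "left_supporters A D (x, y) R = cut_supporters x R"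
proof -
  have xy: "x \<in> \<Omega>" "y \<in> \<Omega>" "x < y" using gap by (auto simp: gap_pairs_def)
  have peaked: "strictly_prefers (R i) x y \<longleftrightarrow> best \<Omega> (R i) \<le> x" if i: "i \<in> A" for i
  proof
    assume "strictly_prefers (R i) x y"
    then have "best \<Omega> (R i) < y"
      using peak_towards(2)[OF R i xy(2,1)] xy(3) by (simp add: strictly_prefers_def)
    then show "best \<Omega> (R i) \<le> x" using gap_pairs_cases[OF gap peak_mem[OF R i]] by simp
  next
    assume "best \<Omega> (R i) \<le> x"
    then show "strictly_prefers (R i) x y"
      using best_single_peaked[OF profile_single_peaked[OF R i] range_subset closed_range xy(1,2)]
        xy(3) by simp
  qed
  have unique: "c' = y" if "(x, c') \<in> gap_pairs \<Omega>" for c'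
  proof -
    have "x < c'" using that by (auto simp: gap_pairs_def)
    then show ?thesis using gap_pairs_eq_or_apart[OF gap that] xy(3) by auto
  qed
  show ?thesis
  proof (intro set_eqI)
    fix i
    show "i \<in> left_supporters A D (x, y) R \<longleftrightarrow> i \<in> cut_supporters x R"
    proof (cases "i \<in> A")
      case True
      then have "i \<notin> D" using disjoint by auto
      then show ?thesis using True peaked[OF True] by (simp add: left_supporters_def cut_supporters_def)
    next
      case False
      have "(\<exists>c'. (x, c') \<in> gap_pairs \<Omega> \<and> strictly_prefers (R i) x c') \<longleftrightarrow> strictly_prefers (R i) x y"
        using gap unique by blast
      then show ?thesis using False by (simp add: left_supporters_def cut_supporters_def)
    qed
  qed
qed

text \<open>Coalitions whose support alone keeps the outcome at most \<open>x\<close>: by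
  \<open>cut_monotone\<close> one such profile settles all. Admitting supersets of the actual
  supporters makes the collection upward closed.\<close>

definition decisive :: "real \<Rightarrow> nat set set" where
  "decisive x = {V. V \<subseteq> A \<union> D \<and> (\<exists>R\<in>profiles X A D. cut_supporters x R \<subseteq> V \<and> f R \<le> x)}"

lemma finite_decisive: "finite (decisive x)"
  by (rule finite_subset[of _ "Pow (A \<union> D)"]) (use finite_agents in \<open>auto simp: decisive_def\<close>)

lemma decisive_up: "V \<in> decisive x \<Longrightarrow> V \<subseteq> V' \<Longrightarrow> V' \<subseteq> A \<union> D \<Longrightarrow> V' \<in> decisive x"
  unfolding decisive_def by blast

lemma outcome_le_iff_decisive:
  assumes R: "R \<in> profiles X A D" and x: "x \<in> \<Omega>"
  shows "f R \<le> x \<longleftrightarrow> cut_supporters x R \<in> decisive x"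
proof
  assume "f R \<le> x"
  moreover have "cut_supporters x R \<subseteq> A \<union> D" by (auto simp: cut_supporters_def)
  ultimately show "cut_supporters x R \<in> decisive x" using R unfolding decisive_def by blast
next
  assume "cut_supporters x R \<in> decisive x"
  then show "f R \<le> x" using cut_monotone[OF _ R x] unfolding decisive_def by blast
qed

text \<open>A decisive coalition of single-peaked agents bounds the outcome whatever
  \<open>D\<close> reports.\<close>

lemma decisive_peaked:
  assumes V: "V \<in> decisive x" "V \<subseteq> A" and x: "x \<in> \<Omega>" and p: "p \<in> A \<rightarrow>\<^sub>E \<Omega>"
    and sub: "V \<subseteq> {i \<in> A. p i \<le> x}"
  shows "median p \<le>\<^sup>* Inl x"
proof -
  have "f R \<le> x" if R: "R \<in> profiles X A D" "peaks A \<Omega> R = p" for R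
  proof -
    have "V \<subseteq> cut_supporters x R" using sub cut_supporters_peaks[of x R] R(2) by auto
    moreover have "cut_supporters x R \<subseteq> A \<union> D" by (auto simp: cut_supporters_def)
    ultimately show ?thesis using outcome_le_iff_decisive[OF R(1) x] decisive_up[OF V(1)] by blast
  qed
  then show ?thesis using median_le_Inl[OF p] by (auto simp: outcomes_def)
qed

lemma median_voting:
  assumes r: "Inr (x, y) \<in> median_range"
    and g: "\<And>R. R \<in> profiles X A D \<Longrightarrow> median (peaks A \<Omega> R) = Inr (x, y) \<Longrightarrow> g R = f R"
  shows "voting_by_left_decisive_sets X A D \<Omega> median_range coalitions median (x, y) g"
proof -
  have gap: "(x, y) \<in> gap_pairs \<Omega>" using r median_range_subset by auto
  then have xy: "x \<in> \<Omega>" "y \<in> \<Omega>" "x < y" by (auto simp: gap_pairs_def)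
  \<comment> \<open>Minimal decisive sets inside \<open>A\<close> can be discarded: were one
    contained in the supporters, \<open>decisive_peaked\<close> would put the median at or below
    \<open>Inl x\<close>, not at the pair.\<close>
  define W where "W = {C. minimal_in (decisive x) C \<and> C \<inter> D \<noteq> {}}"
  have W: "C \<in> decisive x" "C \<subseteq> A \<union> D" if "C \<in> W" for C
    using that by (auto simp: W_def minimal_in_def decisive_def)
  have "minimal_collection W"
    by (auto simp: minimal_collection_def minimal_in_def W_def)
  moreover have "g R = (if \<exists>C\<in>W. C \<subseteq> left_supporters A D (x, y) R then x else y)"
    if R: "R \<in> profiles X A D" and med: "median (peaks A \<Omega> R) = Inr (x, y)" for R
  proof -
    note p = peaks_mem[OF R]
    have "f R \<in> {x, y}"
      using p outcomesI[OF R] med by (cases rule: median_cases) auto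
    moreover have "f R \<le> x \<longleftrightarrow> (\<exists>C\<in>W. C \<subseteq> cut_supporters x R)"
    proof
      assume "f R \<le> x"
      then have "cut_supporters x R \<in> decisive x" using outcome_le_iff_decisive[OF R xy(1)] by simp
      then obtain C where C: "minimal_in (decisive x) C" "C \<subseteq> cut_supporters x R"
        using minimal_in_below[OF finite_decisive] by blast
      have "C \<inter> D \<noteq> {}"
      proof
        assume "C \<inter> D = {}"
        moreover have "C \<in> decisive x" using C(1) by (simp add: minimal_in_def)
        ultimately have "C \<subseteq> A" by (auto simp: decisive_def)
        moreover have "C \<subseteq> {i \<in> A. peaks A \<Omega> R i \<le> x}"
          using \<open>C \<subseteq> A\<close> C(2) cut_supporters_peaks[of x R] by blast
        ultimately have "median (peaks A \<Omega> R) \<le>\<^sup>* Inl x"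
          using decisive_peaked[OF \<open>C \<in> decisive x\<close> _ xy(1) p] by blast
        then show False using med xy(3) by simp
      qed
      then show "\<exists>C\<in>W. C \<subseteq> cut_supporters x R" using C by (auto simp: W_def)
    next
      assume "\<exists>C\<in>W. C \<subseteq> cut_supporters x R"
      moreover have "cut_supporters x R \<subseteq> A \<union> D" by (auto simp: cut_supporters_def)
      ultimately have "cut_supporters x R \<in> decisive x" using W decisive_up by blast
      then show "f R \<le> x" using outcome_le_iff_decisive[OF R xy(1)] by simp
    qed
    ultimately show ?thesis using g[OF R med] left_supporters_eq[OF gap R] xy(3) by auto
  qed
  moreover have "\<exists>C\<in>W. C \<inter> A = B"
    if B: "minimal_in (coalitions (Inr (x, y)) -
      (if Inl x \<in> median_range then coalitions (Inl x) else {})) B" for B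
  proof -
    have B1: "B \<in> coalitions (Inr (x, y))" "Inl x \<in> median_range \<Longrightarrow> B \<notin> coalitions (Inl x)"
      using B by (auto simp: minimal_in_def)
    have Bmin: "\<not> B' \<subset> B"
      if "B' \<in> coalitions (Inr (x, y))" "Inl x \<in> median_range \<Longrightarrow> B' \<notin> coalitions (Inl x)" for B'
      using B that by (auto simp: minimal_in_def)
    have BA: "B \<subseteq> A" by (rule coalitions_subset[OF B1(1)])
    have notmax: "\<not> (\<exists>m. is_max \<Omega> m \<and> Inl x = (Inl m :: real + real \<times> real))"
      "\<not> (\<exists>m. is_max \<Omega> m \<and> Inr (x, y) = (Inl m :: real + real \<times> real))"
      using xy by (auto simp: is_max_def not_le)
    \<comment> \<open>A decisive \<open>B\<close> would belong to \<open>coalitions (Inl x)\<close>,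
      so \<open>Inl x\<close> would be missing from the range. The median at \<open>?p\<close> would
      then lie strictly below \<open>Inl x\<close>, making \<open>x\<close> interior and hence a
      member of the range.\<close>
    have notB: "B \<notin> decisive x"
    proof
      assume dec: "B \<in> decisive x"
      let ?p = "\<lambda>i\<in>A. if i \<in> B then x else y"
      have p: "?p \<in> A \<rightarrow>\<^sub>E \<Omega>" using xy by auto
      have le: "median ?p \<le>\<^sup>* Inl x"
        by (rule decisive_peaked[OF dec BA xy(1) p]) (use BA in auto)
      have "{i \<in> A. Inl (?p i) \<le>\<^sup>* Inl x} \<in> coalitions (Inl x)"
        using median_le_iff[OF p, of "Inl x"] xy(1) le by blast
      moreover have "{i \<in> A. Inl (?p i) \<le>\<^sup>* Inl x} = B" using BA xy(3) by auto
      ultimately have "B \<in> coalitions (Inl x)" by (simp only:)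
      then have nr: "Inl x \<notin> median_range" using B1(2) by blast
      have mr: "median ?p \<in> median_range" using p by (auto simp: median_range_def)
      have "\<exists>u\<in>\<Omega>. u < x"
        using p
      proof (cases rule: median_cases)
        case (single u)
        have "u \<noteq> x"
        proof
          assume "u = x"
          then show False using single(2) mr nr by simp
        qed
        moreover have "u \<le> x" using le single(2) by simp
        ultimately show ?thesis using single(1) by force
      next
        case (gap u v)
        then have "u \<in> \<Omega>" "u < v" by (auto simp: gap_pairs_def)
        moreover have "v \<le> x" using le gap(2) by simp
        ultimately show ?thesis by force
      qed
      then have "\<not> is_min \<Omega> x" unfolding is_min_def by (meson not_le)
      moreover have "\<not> is_max \<Omega> x" using xy(2,3) unfolding is_max_def by (meson not_le)
      ultimately show False using interior_median_range[OF xy(1)] nr by blast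
    qed
    obtain p where p: "p \<in> A \<rightarrow>\<^sub>E \<Omega>" "{i \<in> A. Inl (p i) \<le>\<^sup>* Inr (x, y)} \<subseteq> B"
      "median p \<le>\<^sup>* Inr (x, y)"
      using B1(1) coalitions_iff[OF notmax(2)] by blast
    obtain R where R: "R \<in> profiles X A D" "peaks A \<Omega> R = p" "f R \<le> x"
      using median_le_Inr[OF p(1)] p(3) by (auto simp: outcomes_def)
    have "cut_supporters x R \<subseteq> B \<union> D"
    proof
      fix i assume i: "i \<in> cut_supporters x R"
      show "i \<in> B \<union> D"
      proof (cases "i \<in> A")
        case True
        then have "p i \<le> x" using i cut_supporters_peaks[of x R] R(2) by blast
        then show ?thesis using True p(2) by auto
      next
        case False
        then show ?thesis using i by (auto simp: cut_supporters_def)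
      qed
    qed
    \<comment> \<open>A minimal decisive \<open>C\<close> inside \<open>B \<union> D\<close> must
      meet \<open>D\<close>, as \<open>B\<close> is not decisive. Its part in \<open>A\<close> again
      lies in the difference of the two collections, so minimality of \<open>B\<close> gives
      equality.\<close>
    then have "B \<union> D \<in> decisive x" using BA R(1,3) unfolding decisive_def by blast
    then obtain C where C: "minimal_in (decisive x) C" "C \<subseteq> B \<union> D"
      using minimal_in_below[OF finite_decisive] by blast
    then have Cdec: "C \<in> decisive x" by (simp add: minimal_in_def)
    have "C \<inter> D \<noteq> {}"
    proof
      assume "C \<inter> D = {}"
      then have "C \<subseteq> B" using C(2) by auto
      then show False using decisive_up[OF Cdec] BA notB by blast
    qed
    then have "C \<in> W" using C(1) by (simp add: W_def)
    have "C \<inter> A \<subseteq> B" using C(2) disjoint by auto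
    have "C \<inter> A \<in> coalitions (Inr (x, y))"
    proof -
      obtain T where T: "T \<in> profiles X A D" "cut_supporters x T \<subseteq> C" "f T \<le> x"
        using Cdec unfolding decisive_def by blast
      have "{i \<in> A. Inl (peaks A \<Omega> T i) \<le>\<^sup>* Inr (x, y)} \<subseteq> C \<inter> A"
        using T(2) cut_supporters_peaks[of x T] by auto
      moreover have "median (peaks A \<Omega> T) \<le>\<^sup>* Inr (x, y)"
        using median_le_Inr[OF peaks_mem[OF T(1)]] outcomesI[OF T(1)] T(3) by blast
      ultimately show ?thesis
        using coalitions_iff[OF notmax(2)] peaks_mem[OF T(1)] by blast
    qed
    moreover have "C \<inter> A \<notin> coalitions (Inl x)" if "Inl x \<in> median_range"
      using coalitions_up[OF _ \<open>C \<inter> A \<subseteq> B\<close> BA] B1(2)[OF that] by blast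
    ultimately have "C \<inter> A = B" using Bmin \<open>C \<inter> A \<subseteq> B\<close> by blast
    then show ?thesis using \<open>C \<in> W\<close> by blast
  qed
  ultimately show ?thesis
    unfolding voting_by_left_decisive_sets_def
    using W(2) by (intro exI[of _ W]) (auto simp: W_def)
qed

lemma median_representation:
  "\<exists>r \<L> \<omega> g. generalized_median_voter A \<Omega> r \<L> \<omega> \<and>
     (\<forall>\<alpha>. Inr \<alpha> \<in> r \<longrightarrow> g \<alpha> \<in> profiles X A D \<rightarrow> {fst \<alpha>, snd \<alpha>} \<and>
        voting_by_left_decisive_sets X A D \<Omega> r \<L> \<omega> \<alpha> (g \<alpha>)) \<and>
     (\<forall>R\<in>profiles X A D. f R = (case \<omega> (peaks A \<Omega> R) of Inl x \<Rightarrow> x | Inr \<alpha> \<Rightarrow> g \<alpha> R))"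
proof -
  \<comment> \<open>Where the median is not \<open>\<alpha>\<close>, the default
    \<open>fst \<alpha>\<close> keeps \<open>g \<alpha>\<close> within its two values.\<close>
  define g where "g \<alpha> R = (if median (peaks A \<Omega> R) = Inr \<alpha> then f R else fst \<alpha>)" for \<alpha> R
  have "g \<alpha> \<in> profiles X A D \<rightarrow> {fst \<alpha>, snd \<alpha>}" for \<alpha>
  proof
    fix R assume R: "R \<in> profiles X A D"
    have "f R \<in> {fst \<alpha>, snd \<alpha>}" if "median (peaks A \<Omega> R) = Inr \<alpha>"
      using peaks_mem[OF R] outcomesI[OF R] that by (cases rule: median_cases) auto
    then show "g \<alpha> R \<in> {fst \<alpha>, snd \<alpha>}" by (simp add: g_def)
  qed
  moreover have "voting_by_left_decisive_sets X A D \<Omega> median_range coalitions median \<alpha> (g \<alpha>)"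
    if "Inr \<alpha> \<in> median_range" for \<alpha>
    using that median_voting[of "fst \<alpha>" "snd \<alpha>" "g \<alpha>"] by (simp add: g_def)
  moreover have "f R = (case median (peaks A \<Omega> R) of Inl x \<Rightarrow> x | Inr \<alpha> \<Rightarrow> g \<alpha> R)"
    if R: "R \<in> profiles X A D" for R
  proof (cases "median (peaks A \<Omega> R)")
    case (Inl x)
    from peaks_mem[OF R] have "outcomes (peaks A \<Omega> R) = {x}"
      by (cases rule: median_cases) (use Inl in auto)
    then show ?thesis using outcomesI[OF R] Inl by simp
  qed (simp add: g_def)
  ultimately show ?thesis using median_generalized by blast
qed

end

section \<open>Group strategy-proofness of generalized median voter schemes\<close>

text \<open>The definition singles out the first element of \<open>r\<close> whose support is in its
  collection. Supports grow along the order and the collections are monotone, so the same holds at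
  every later element.\<close>

lemma generalized_median_voter_le_iff:
  assumes gmv: "generalized_median_voter A \<Omega> r \<L> \<omega>" and p: "p \<in> A \<rightarrow>\<^sub>E \<Omega>" and \<alpha>: "\<alpha> \<in> r"
  shows "\<omega> p \<le>\<^sup>* \<alpha> \<longleftrightarrow> {i \<in> A. Inl (p i) \<le>\<^sup>* \<alpha>} \<in> \<L> \<alpha>"
proof -
  have rsub: "r \<subseteq> \<Omega> <+> gap_pairs \<Omega>"
    using gmv by (simp add: generalized_median_voter_def range_conditions_def)
  have r: "\<omega> p \<in> r" using gmv p by (auto simp: generalized_median_voter_def)
  have "\<forall>p\<in>A \<rightarrow>\<^sub>E \<Omega>. \<forall>\<alpha>\<in>r. \<omega> p = \<alpha> \<longleftrightarrow> {i \<in> A. Inl (p i) \<le>\<^sup>* \<alpha>} \<in> \<L> \<alpha> \<and>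
      (\<forall>\<beta>\<in>r. \<beta> <\<^sup>* \<alpha> \<longrightarrow> {i \<in> A. Inl (p i) \<le>\<^sup>* \<beta>} \<notin> \<L> \<beta>)"
    using gmv unfolding generalized_median_voter_def by (elim conjE)
  then have char: "{i \<in> A. Inl (p i) \<le>\<^sup>* \<omega> p} \<in> \<L> (\<omega> p)"
    "\<And>\<beta>. \<beta> \<in> r \<Longrightarrow> \<beta> <\<^sup>* \<omega> p \<Longrightarrow> {i \<in> A. Inl (p i) \<le>\<^sup>* \<beta>} \<notin> \<L> \<beta>"
    using p r by blast+
  have lcs: "left_coalition_system A \<Omega> r \<L>" using gmv by (simp add: generalized_median_voter_def)
  have up: "C' \<in> \<L> \<alpha>" if "C \<in> \<L> \<alpha>" "C \<subseteq> C'" "C' \<subseteq> A" for C C'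
  proof (cases "C = C'")
    case False
    then have "C \<subset> C'" using that(2) by blast
    then show ?thesis using lcs \<alpha> that unfolding left_coalition_system_def by blast
  qed (use that in simp)
  have mono: "C \<in> \<L> \<beta>" if "\<beta> \<in> r" "\<gamma> \<in> r" "\<gamma> <\<^sup>* \<beta>" "C \<in> \<L> \<gamma>" for C \<beta> \<gamma>
    using lcs that unfolding left_coalition_system_def by blast
  note iff = less_star_iff[OF subsetD[OF rsub \<alpha>] subsetD[OF rsub r]]
  show ?thesis
  proof
    assume le: "\<omega> p \<le>\<^sup>* \<alpha>"
    have "{i \<in> A. Inl (p i) \<le>\<^sup>* \<omega> p} \<in> \<L> \<alpha>"
    proof (cases "\<alpha> \<le>\<^sup>* \<omega> p")
      case True
      then have "\<omega> p = \<alpha>" using le_star_antisym[OF subsetD[OF rsub r] subsetD[OF rsub \<alpha>] le] by blast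
      then show ?thesis using char(1) by simp
    next
      case False
      then have "\<omega> p <\<^sup>* \<alpha>" using le by (simp add: less_star_def)
      then show ?thesis using mono[OF \<alpha> r _ char(1)] by blast
    qed
    moreover have "{i \<in> A. Inl (p i) \<le>\<^sup>* \<omega> p} \<subseteq> {i \<in> A. Inl (p i) \<le>\<^sup>* \<alpha>}"
    proof
      fix i assume i: "i \<in> {i \<in> A. Inl (p i) \<le>\<^sup>* \<omega> p}"
      then have "Inl (p i) \<in> \<Omega> <+> gap_pairs \<Omega>" using p by auto
      then show "i \<in> {i \<in> A. Inl (p i) \<le>\<^sup>* \<alpha>}"
        using le_star_trans[OF _ subsetD[OF rsub r] subsetD[OF rsub \<alpha>] _ le] i by blast
    qed
    ultimately show "{i \<in> A. Inl (p i) \<le>\<^sup>* \<alpha>} \<in> \<L> \<alpha>" using up by blast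
  next
    assume "{i \<in> A. Inl (p i) \<le>\<^sup>* \<alpha>} \<in> \<L> \<alpha>"
    then show "\<omega> p \<le>\<^sup>* \<alpha>" using char(2)[OF \<alpha>] iff by blast
  qed
qed

lemma (in voting_rule) median_voting_group_strategy_proof:
  assumes gmv: "generalized_median_voter A \<Omega> r \<L> \<omega>"
    and voting: "\<And>\<alpha>. Inr \<alpha> \<in> r \<Longrightarrow> g \<alpha> \<in> profiles X A D \<rightarrow> {fst \<alpha>, snd \<alpha>} \<and>
      voting_by_left_decisive_sets X A D \<Omega> r \<L> \<omega> \<alpha> (g \<alpha>)"
    and f: "\<And>R. R \<in> profiles X A D \<Longrightarrow> f R = (case \<omega> (peaks A \<Omega> R) of Inl x \<Rightarrow> x | Inr \<alpha> \<Rightarrow> g \<alpha> R)"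
  shows "group_strategy_proof X A D f"
  unfolding group_strategy_proof_def
proof (intro allI impI notI)
  fix S assume S: "S \<subseteq> A \<union> D \<and> S \<noteq> {}" and "manipulable_by X A D f S"
  then obtain R R' where R: "R \<in> profiles X A D" and R': "R' \<in> (\<Pi>\<^sub>E i\<in>S. prefs X A i)"
    and gain: "\<And>i. i \<in> S \<Longrightarrow> strictly_prefers (R i) (f (override_on R R' S)) (f R)"
    unfolding manipulable_by_def by blast
  define T where "T = override_on R R' S"
  have T: "T \<in> profiles X A D"
    using R R' S unfolding T_def profiles_def by (auto simp: override_on_def PiE_def extensional_def Pi_def)
  have TR: "T i = R i" if "i \<notin> S" for i using that by (simp add: T_def)
  note gain = gain[folded T_def]
  define p q where "p = peaks A \<Omega> R" and "q = peaks A \<Omega> T"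
  have p: "p \<in> A \<rightarrow>\<^sub>E \<Omega>" and q: "q \<in> A \<rightarrow>\<^sub>E \<Omega>" using peaks_mem R T by (auto simp: p_def q_def)
  have pq: "q i = p i" if "i \<notin> S" for i using TR[OF that] by (simp add: p_def q_def peaks_def)
  have pb: "p i = best \<Omega> (R i)" if "i \<in> A" for i using that by (simp add: p_def peaks_def)
  have rc: "range_conditions \<Omega> r" using gmv by (simp add: generalized_median_voter_def)
  then have mem: "\<And>\<alpha>. \<alpha> \<in> r \<Longrightarrow> \<alpha> \<in> \<Omega> <+> gap_pairs \<Omega>" unfolding range_conditions_def by blast
  have \<omega>r: "\<omega> p \<in> r" "\<omega> q \<in> r" using gmv p q by (auto simp: generalized_median_voter_def)
  note le_iff = generalized_median_voter_le_iff[OF gmv]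
  have val: "(\<exists>x. \<omega> u = Inl x \<and> f V = x) \<or>
      (\<exists>x y. \<omega> u = Inr (x, y) \<and> (x, y) \<in> gap_pairs \<Omega> \<and> x < y \<and> f V \<in> {x, y})"
    if u: "V \<in> profiles X A D" "u = peaks A \<Omega> V" "\<omega> u \<in> r" for V u
  proof (cases "\<omega> u")
    case (Inl x)
    then show ?thesis using f[OF u(1)] u(2) by simp
  next
    case (Inr \<alpha>)
    then have "g \<alpha> V \<in> {fst \<alpha>, snd \<alpha>}" using voting[of \<alpha>] u by auto
    moreover have "\<alpha> \<in> gap_pairs \<Omega>" using mem[OF u(3)] Inr by auto
    ultimately show ?thesis using f[OF u(1)] u(2) Inr by (cases \<alpha>) (auto simp: gap_pairs_def)
  qed
  \<comment> \<open>A strict rise of \<open>\<omega>\<close> cannot lower the outcome: distinct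
    values, read as points and intervals, share at most an end point.\<close>
  have val_le: "f V \<le> f V'"
    if V: "V \<in> profiles X A D" "u = peaks A \<Omega> V" "\<omega> u \<in> r"
      and V': "V' \<in> profiles X A D" "u' = peaks A \<Omega> V'" "\<omega> u' \<in> r"
      and lt: "\<omega> u \<le>\<^sup>* \<omega> u'" "\<omega> u \<noteq> \<omega> u'" for V V' u u'
    using val[OF V]
  proof (elim disjE exE conjE)
    fix x assume x: "\<omega> u = Inl x" "f V = x"
    show ?thesis using val[OF V'] lt x by auto
  next
    fix x y assume x: "\<omega> u = Inr (x, y)" "(x, y) \<in> gap_pairs \<Omega>" "x < y" "f V \<in> {x, y}"
    show ?thesis using val[OF V']
    proof (elim disjE exE conjE)
      fix x' assume "\<omega> u' = Inl x'" "f V' = x'"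
      then show ?thesis using lt x by auto
    next
      fix x' y' assume x': "\<omega> u' = Inr (x', y')" "(x', y') \<in> gap_pairs \<Omega>" "x' < y'" "f V' \<in> {x', y'}"
      have "x \<le> x'" "\<not> (x = x' \<and> y = y')" using lt x(1) x'(1) by auto
      then have "y \<le> x'" using gap_pairs_eq_or_apart[OF x(2) x'(2)] x'(3) by linarith
      then show ?thesis using x(3,4) x'(3,4) by auto
    qed
  qed
  have ne: "f T \<noteq> f R"
  proof -
    obtain i where "i \<in> S" using S by blast
    then show ?thesis using gain[of i] by (auto simp: strictly_prefers_def)
  qed
  have peak_lt: "p i < f R" if "i \<in> S" "i \<in> A" "f T < f R" for i
    using peak_towards(2)[OF R that(2) outcome[OF R] outcome[OF T]] gain[OF that(1)] that pb
    by (simp add: strictly_prefers_def)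
  have peak_gt: "f R < p i" if "i \<in> S" "i \<in> A" "f R < f T" for i
    using peak_towards(1)[OF R that(2) outcome[OF R] outcome[OF T]] gain[OF that(1)] that pb
    by (simp add: strictly_prefers_def)
  show False
  proof (cases "\<omega> p = \<omega> q")
    case True
    have "\<exists>x y. \<omega> p = Inr (x, y)"
      using val[OF R p_def \<omega>r(1)] val[OF T q_def \<omega>r(2)] True ne by auto
    then obtain x y where xy: "\<omega> p = Inr (x, y)" by blast
    then have "x < y" using val[OF R p_def \<omega>r(1)] by auto
    have "voting_by_left_decisive_sets X A D \<Omega> r \<L> \<omega> (x, y) (g (x, y))"
      using voting[of "(x, y)"] \<omega>r(1) xy by simp
    then obtain W where "\<forall>V\<in>profiles X A D. \<omega> (peaks A \<Omega> V) = Inr (x, y) \<longrightarrow> g (x, y) V =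
        (if \<exists>C\<in>W. C \<subseteq> left_supporters A D (x, y) V then fst (x, y) else snd (x, y))"
      unfolding voting_by_left_decisive_sets_def by (elim exE conjE) (rule that)
    then have W: "g (x, y) V = (if \<exists>C\<in>W. C \<subseteq> left_supporters A D (x, y) V then x else y)"
      if "V \<in> profiles X A D" "\<omega> (peaks A \<Omega> V) = Inr (x, y)" for V
      using that by simp
    have fR: "f R = (if \<exists>C\<in>W. C \<subseteq> left_supporters A D (x, y) R then x else y)"
      using W[OF R] f[OF R] xy by (simp add: p_def)
    have fT: "f T = (if \<exists>C\<in>W. C \<subseteq> left_supporters A D (x, y) T then x else y)"
      using W[OF T] f[OF T] xy True by (simp add: q_def)
    have sup: "i \<in> left_supporters A D (x, y) T \<longleftrightarrow> i \<in> left_supporters A D (x, y) R" if "i \<notin> S" for i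
      using TR[OF that] by (simp add: left_supporters_def)
    \<comment> \<open>Deviators who gain by moving from \<open>y\<close> to \<open>x\<close> already
      supported \<open>x\<close> at \<open>R\<close>, so the support cannot have grown and the vote
      cannot have turned to \<open>x\<close>. The other direction is analogous.\<close>
    have "left_supporters A D (x, y) T \<subseteq> left_supporters A D (x, y) R" if "f T = x" "f R = y"
    proof
      fix i assume i: "i \<in> left_supporters A D (x, y) T"
      show "i \<in> left_supporters A D (x, y) R"
      proof (cases "i \<in> S")
        case True
        then show ?thesis using gain[OF True] that S by (auto simp: left_supporters_def)
      next
        case False
        then show ?thesis using sup i by blast
      qed
    qed
    moreover have "left_supporters A D (x, y) R \<subseteq> left_supporters A D (x, y) T" if "f T = y" "f R = x"
    proof
      fix i assume i: "i \<in> left_supporters A D (x, y) R"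
      show "i \<in> left_supporters A D (x, y) T"
      proof (cases "i \<in> S")
        case True
        then show ?thesis using gain[OF True] that i by (simp add: left_supporters_def strictly_prefers_def)
      next
        case False
        then show ?thesis using sup i by blast
      qed
    qed
    ultimately show False using fR fT ne by (auto split: if_splits)
  next
    case False
    have total: "\<omega> p \<le>\<^sup>* \<omega> q \<or> \<omega> q \<le>\<^sup>* \<omega> p" using le_star_total[OF mem mem] \<omega>r by blast
    have anti: "\<not> (\<omega> p \<le>\<^sup>* \<omega> q \<and> \<omega> q \<le>\<^sup>* \<omega> p)"
      using le_star_antisym[OF mem mem] \<omega>r False by blast
    have lcs: "left_coalition_system A \<Omega> r \<L>" using gmv by (simp add: generalized_median_voter_def)
    have up: "C' \<in> \<L> \<alpha>" if "\<alpha> \<in> r" "C \<in> \<L> \<alpha>" "C \<subseteq> C'" "C' \<subseteq> A" for \<alpha> C C'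
    proof (cases "C = C'")
      case False
      then have "C \<subset> C'" using that(3) by blast
      then show ?thesis using lcs that unfolding left_coalition_system_def by blast
    qed (use that in simp)
    have move: "\<omega> v \<le>\<^sup>* \<alpha>"
      if "\<alpha> \<in> r" "\<omega> u \<le>\<^sup>* \<alpha>" "u \<in> A \<rightarrow>\<^sub>E \<Omega>" "v \<in> A \<rightarrow>\<^sub>E \<Omega>"
        and "\<And>i. i \<in> A \<Longrightarrow> Inl (u i) \<le>\<^sup>* \<alpha> \<Longrightarrow> Inl (v i) \<le>\<^sup>* \<alpha>" for \<alpha> u v
    proof -
      have "{i \<in> A. Inl (u i) \<le>\<^sup>* \<alpha>} \<subseteq> {i \<in> A. Inl (v i) \<le>\<^sup>* \<alpha>}" using that(5) by blast
      then show ?thesis using le_iff[OF that(3,1)] le_iff[OF that(4,1)] that(2) up[OF that(1)] by blast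
    qed
    show False
    proof (cases "f R < f T")
      case up: True
      then have "\<omega> p \<le>\<^sup>* \<omega> q" using val_le[OF T q_def \<omega>r(2) R p_def \<omega>r(1)] total False by fastforce
      moreover have "\<omega> q \<le>\<^sup>* \<omega> p"
      proof (rule move[OF \<omega>r(1) le_star_refl p q])
        fix i assume i: "i \<in> A" "Inl (p i) \<le>\<^sup>* \<omega> p"
        have "i \<notin> S"
        proof
          assume "i \<in> S"
          then have "f R < p i" by (rule peak_gt[OF _ i(1) up])
          then show False using val[OF R p_def \<omega>r(1)] i(2) by auto
        qed
        then show "Inl (q i) \<le>\<^sup>* \<omega> p" using pq i(2) by simp
      qed
      ultimately show False using anti by blast
    next
      case down: False
      then have lt: "f T < f R" using ne by simp
      then have qp: "\<omega> q \<le>\<^sup>* \<omega> p"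
        using val_le[OF R p_def \<omega>r(1) T q_def \<omega>r(2)] total False by fastforce
      show False
      proof (cases "\<forall>i\<in>S \<inter> A. Inl (p i) \<le>\<^sup>* \<omega> q")
        case True
        have "\<omega> p \<le>\<^sup>* \<omega> q"
        proof (rule move[OF \<omega>r(2) le_star_refl q p])
          fix i assume "i \<in> A" "Inl (q i) \<le>\<^sup>* \<omega> q"
          then show "Inl (p i) \<le>\<^sup>* \<omega> q" using True pq by (cases "i \<in> S") auto
        qed
        then show False using anti qp by blast
      next
        case False
        \<comment> \<open>\<open>m\<close> has an outcome below it, found from
          \<open>\<omega> q\<close>, and \<open>f R\<close> above it, so it is interior and
          \<open>Inl m\<close> lies in \<open>r\<close>. No deviator's true peak exceeds
          \<open>m\<close>, so passing from \<open>q\<close> back to \<open>p\<close> loses no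
          support there.\<close>
        define m where "m = Max (p ` (S \<inter> A))"
        have fin: "finite (p ` (S \<inter> A))" using finite_agents by auto
        obtain j where j: "j \<in> S \<inter> A" "\<not> Inl (p j) \<le>\<^sup>* \<omega> q" using False by blast
        have le_m: "p i \<le> m" if "i \<in> S \<inter> A" for i using fin that by (simp add: m_def)
        have "m \<in> p ` (S \<inter> A)" unfolding m_def by (rule Max_in[OF fin]) (use j(1) in blast)
        then obtain k where k: "k \<in> S" "k \<in> A" "m = p k" by blast
        have m\<Omega>: "m \<in> \<Omega>" using k p by auto
        have m_lt: "m < f R" using peak_lt[OF k(1,2) lt] k(3) by simp
        have m_gt: "\<not> Inl m \<le>\<^sup>* \<omega> q"
        proof
          assume "Inl m \<le>\<^sup>* \<omega> q"
          then have "Inl (p j) \<le>\<^sup>* \<omega> q" using le_m[OF j(1)] by (cases "\<omega> q") auto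
          then show False using j(2) by blast
        qed
        have q_le: "\<omega> q \<le>\<^sup>* Inl m"
          using le_star_total[OF mem[OF \<omega>r(2)], of "Inl m"] m_gt m\<Omega> by blast
        have "\<exists>u\<in>\<Omega>. u < m"
          using mem[OF \<omega>r(2)] m_gt q_le by (cases "\<omega> q") (auto simp: gap_pairs_def not_le)
        then have "\<not> is_min \<Omega> m" unfolding is_min_def by (meson not_le)
        moreover have "\<not> is_max \<Omega> m" using m_lt outcome[OF R] unfolding is_max_def by (meson not_le)
        ultimately have mr: "Inl m \<in> r" using rc m\<Omega> by (auto simp: range_conditions_def)
        have "\<omega> p \<le>\<^sup>* Inl m"
        proof (rule move[OF mr q_le q p])
          fix i assume "i \<in> A" "Inl (q i) \<le>\<^sup>* Inl m"
          then show "Inl (p i) \<le>\<^sup>* Inl m" using le_m pq by (cases "i \<in> S") auto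
        qed
        then show False using val[OF R p_def \<omega>r(1)] m_lt by auto
      qed
    qed
  qed
qed

theorem theorem1:
  fixes X \<Omega> :: "real set" and n :: nat and A D :: "nat set"
    and f :: "(nat \<Rightarrow> real rel) \<Rightarrow> real"
  assumes "A \<union> D = {1..n}" and "A \<inter> D = {}"
    and "f \<in> profiles X A D \<rightarrow> X"
    and "f ` profiles X A D = \<Omega>"
    and "open (- \<Omega>)"
    and "infinite \<Omega> \<or> card \<Omega> \<ge> 2"
  shows "(strategy_proof X A D f \<longleftrightarrow> group_strategy_proof X A D f) \<and>
    (group_strategy_proof X A D f \<longleftrightarrow>
      (\<exists>r \<L> \<omega> g.
         generalized_median_voter A \<Omega> r \<L> \<omega> \<and>
         (\<forall>\<alpha>. Inr \<alpha> \<in> r \<longrightarrow>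
            g \<alpha> \<in> profiles X A D \<rightarrow> {fst \<alpha>, snd \<alpha>} \<and>
            voting_by_left_decisive_sets X A D \<Omega> r \<L> \<omega> \<alpha> (g \<alpha>)) \<and>
         (\<forall>R\<in>profiles X A D.
            f R = (case \<omega> (peaks A \<Omega> R) of Inl x \<Rightarrow> x | Inr \<alpha> \<Rightarrow> g \<alpha> R))))"
    (is "(_ \<longleftrightarrow> _) \<and> (_ \<longleftrightarrow> ?representable)")
proof -
  obtain u v where "u \<in> \<Omega>" "v \<in> \<Omega>" "u \<noteq> v"
  proof (cases "finite \<Omega>")
    case True
    then have "2 \<le> card \<Omega>" using assms(6) by simp
    then obtain B where "B \<subseteq> \<Omega>" "card B = 2" by (rule obtain_subset_with_card_n)
    then show ?thesis using that by (auto simp: card_2_iff)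
  next
    case False
    then obtain B where "B \<subseteq> \<Omega>" "card B = 2" using infinite_arbitrarily_large by blast
    then show ?thesis using that by (auto simp: card_2_iff)
  qed
  then have two: "\<exists>u\<in>\<Omega>. \<exists>v\<in>\<Omega>. u < v" by (meson linorder_neqE_linordered_idom)
  have "finite (A \<union> D)" "closed \<Omega>" using assms(1,5) by (simp_all add: closed_def)
  then have rule: "voting_rule X \<Omega> A D f"
    using assms(2-4) two by unfold_locales
  \<comment> \<open>The implications form a cycle: group strategy-proofness, strategy-proofness,
    representation, and back.\<close>
  have "strategy_proof X A D f" if "group_strategy_proof X A D f"
    using that unfolding strategy_proof_def group_strategy_proof_def by (metis card.empty zero_neq_one)
  moreover have ?representable if "strategy_proof X A D f"
  proof -
    interpret strategy_proof_rule X \<Omega> A D f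
      using rule that by (simp add: strategy_proof_rule_def strategy_proof_rule_axioms_def)
    show ?thesis by (rule median_representation)
  qed
  moreover have "group_strategy_proof X A D f" if ?representable
    using that voting_rule.median_voting_group_strategy_proof[OF rule] by blast
  ultimately show ?thesis by blast
qed

end
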